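(* Let $\Gamma=\mathrm{PSL}_2(\mathbb{Z})$. For every $M=\begin{pmatrix} y&x\\ 0&1\end{pmatrix}\in\mathrm{GL}_2(\mathbb{R})$ with $y>0$ we have \[ \sum_{\gamma\in\Gamma}\alpha(M\gamma)\;=\;\frac{1+\operatorname{sgn}(y-1)}{2}. \]
   Context: Let $\mathfrak{H}$ be the complex upper half-plane and $\mathcal{F}^-=\{z\in\mathfrak{H}:-1/2\le\operatorname{Re} z\le 0,\ |z|\ge 1\}$. Define $\chi^-:\mathfrak{H}\to\mathbb{Q}$ by $\chi^-(z)=\frac{1}{2\pi}\times$(the angle subtended by $\mathcal{F}^-$ at $z$), i.e. the limiting fraction of a small disc around $z$ lying in $\mathcal{F}^-$; thus $\chi^-$ is $1$ in the interior of $\mathcal{F}^-$, $0$ outside $\mathcal{F}^-$, $1/2$ at boundary points of $\mathcal{F}^-$ other than the corners, $1/4$ at $i$ and $1/6$ at $\rho^2=e^{2\pi i/3}$. Define $\alpha:\mathrm{GL}_2^+(\mathbb{R})\to\mathbb{Q}$ by: $\alpha(M)=\chi^-(z_M)$ if $M$ is elliptic (i.e. $(\operatorname{tr}M)^2<4\det M$), where $z_M$ is the fixed point of $M$ in $\mathfrak{H}$ under Möbius action; $\alpha(M)=-1/12$ if $M$ is a scalar matrix; and $\alpha(M)=0$ if $M$ is parabolic or hyperbolic (i.e. non-scalar with $(\operatorname{tr}M)^2\ge 4\det M$). Since $\alpha(-M)=\alpha(M)$, $\alpha(M\gamma)$ is well defined for $\gamma\in\mathrm{PSL}_2(\mathbb{Z})$.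 *)

theory Defs
  imports "HOL-Analysis.Analysis" "HOL-Algebra.Coset"
begin

definition upper_half_plane :: "complex set" where
  "upper_half_plane = {z. Im z > 0}"

definition F_minus :: "complex set" where
  "F_minus = {z \<in> upper_half_plane. - (1/2) \<le> Re z \<and> Re z \<le> 0 \<and> norm z \<ge> 1}"

text \<open>The angle subtended by \<^term>\<open>F_minus\<close> at \<open>z\<close>, divided by \<open>2\<pi>\<close>, as the limiting fraction
  of the area of a small disc around \<open>z\<close> that lies in \<^term>\<open>F_minus\<close>.\<close>

definition chi_minus :: "complex \<Rightarrow> real" where
  "chi_minus z =
     Lim (at_right 0) (\<lambda>r. measure lborel (ball z r \<inter> F_minus) / measure lborel (ball z r))"

definition mobius :: "real^2^2 \<Rightarrow> complex \<Rightarrow> complex" where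
  "mobius M z = (of_real (M$1$1) * z + of_real (M$1$2)) / (of_real (M$2$1) * z + of_real (M$2$2))"

definition elliptic :: "real^2^2 \<Rightarrow> bool" where
  "elliptic M \<longleftrightarrow> (trace M)\<^sup>2 < 4 * det M"

definition fixed_point :: "real^2^2 \<Rightarrow> complex" where
  "fixed_point M = (THE z. z \<in> upper_half_plane \<and> mobius M z = z)"

text \<open>Only the values at matrices of positive determinant are meaningful.\<close>

definition alpha :: "real^2^2 \<Rightarrow> real" where
  "alpha M = (if elliptic M then chi_minus (fixed_point M)
              else if \<exists>c. M = mat c then - (1/12)
              else 0)"

definition SL2Z :: "(int^2^2) monoid" where
  "SL2Z = \<lparr>carrier = {A. det A = 1}, mult = (**), one = mat 1\<rparr>"

definition PSL2Z :: "(int^2^2) set monoid" where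
  "PSL2Z = SL2Z Mod {mat 1, - mat 1}"

text \<open>The value \<open>\<alpha>(M\<gamma>)\<close> for \<open>\<gamma> = {A, -A}\<close> in \<^term>\<open>PSL2Z\<close>: the common value of \<^term>\<open>alpha\<close>
  on the products of \<open>M\<close> with the two representatives of \<open>\<gamma>\<close>.\<close>

definition alpha_PSL :: "real^2^2 \<Rightarrow> (int^2^2) set \<Rightarrow> real" where
  "alpha_PSL M \<gamma> = the_elem ((\<lambda>A. alpha (M ** map_matrix real_of_int A)) ` \<gamma>)"


lemma matrix_eq_2: "(A::'a^2^2) = B \<longleftrightarrow>
    A$1$1 = B$1$1 \<and> A$1$2 = B$1$2 \<and> A$2$1 = B$2$1 \<and> A$2$2 = B$2$2"
  by (auto simp: vec_eq_iff forall_2)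

lemma uminus_matrix_mul: "(- A) ** B = - (A ** B)" for A B :: "'a::comm_ring_1^2^2"
  by (simp add: matrix_eq_2 matrix_matrix_mult_def sum_2)

lemma matrix_mul_uminus: "A ** (- B) = - (A ** B)" for A B :: "'a::comm_ring_1^2^2"
  by (simp add: matrix_eq_2 matrix_matrix_mult_def sum_2)

lemma group_SL2Z: "group SL2Z"
proof (rule groupI)
  fix A assume A: "A \<in> carrier SL2Z"
  define B :: "int^2^2" where
    "B = vector [vector [A$2$2, - A$1$2], vector [- A$2$1, A$1$1]]"
  have "A$1$1 * A$2$2 - A$1$2 * A$2$1 = 1"
    using A by (simp add: SL2Z_def det_2)
  then have "det B = 1" "B ** A = mat 1"
    by (auto simp: B_def det_2 matrix_eq_2 matrix_matrix_mult_def sum_2 mat_def algebra_simps)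
  then show "\<exists>B\<in>carrier SL2Z. B \<otimes>\<^bsub>SL2Z\<^esub> A = \<one>\<^bsub>SL2Z\<^esub>"
    by (auto simp: SL2Z_def)
qed (auto simp: SL2Z_def det_mul matrix_mul_assoc)

lemma normal_pm_one: "normal {mat 1, - mat 1} SL2Z"
proof -
  interpret group SL2Z by (rule group_SL2Z)
  have det_uminus: "det (- mat 1 :: int^2^2) = 1"
    by (simp add: det_2 mat_def)
  have "inv\<^bsub>SL2Z\<^esub> (- mat 1) = (- mat 1 :: int^2^2)"
    by (rule inv_equality) (auto simp: SL2Z_def det_uminus uminus_matrix_mul matrix_mul_uminus)
  moreover have "inv\<^bsub>SL2Z\<^esub> (mat 1) = (mat 1 :: int^2^2)"
    by (rule inv_equality) (auto simp: SL2Z_def)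
  ultimately have "subgroup {mat 1, - mat 1} SL2Z"
    by (intro subgroupI)
      (auto simp: SL2Z_def det_uminus uminus_matrix_mul matrix_mul_uminus)
  then show ?thesis
    by (rule normalI)
      (auto simp: SL2Z_def r_coset_def l_coset_def uminus_matrix_mul matrix_mul_uminus)
qed

lemma carrier_PSL2Z: "carrier PSL2Z = (\<lambda>A. {A, - A}) ` {A. det A = 1}"
  by (auto simp: PSL2Z_def FactGroup_def RCOSETS_def r_coset_def SL2Z_def uminus_matrix_mul)

lemma alpha_uminus: "alpha (- M) = alpha M"
proof -
  have "mobius (- M) z = mobius M z" for z
    using minus_divide_divide[of "of_real (M$1$1) * z + of_real (M$1$2)"
        "of_real (M$2$1) * z + of_real (M$2$2)"]
    by (simp add: mobius_def algebra_simps)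
  moreover have "(\<exists>c. - M = mat c) \<longleftrightarrow> (\<exists>c. M = mat c)"
    by (auto simp: matrix_eq_2 mat_def minus_equation_iff) (metis minus_minus)+
  moreover have "elliptic (- M) \<longleftrightarrow> elliptic M"
    by (simp add: elliptic_def trace_def sum_2 det_2 power2_eq_square algebra_simps)
  ultimately show ?thesis
    by (simp add: alpha_def fixed_point_def)
qed

lemma alpha_PSL_eq: "alpha_PSL M {A, - A} = alpha (M ** map_matrix real_of_int A)"
proof -
  have "map_matrix real_of_int (- A) = - map_matrix real_of_int A"
    by (simp add: matrix_eq_2)
  then show ?thesis
    by (simp add: alpha_PSL_def matrix_mul_uminus alpha_uminus)
qed

end

theory Submission
  imports Defs
begin

text \<open>
  Represent an element of \<open>PSL\<^sub>2(\<int>)\<close> that is not a translation by \<open>\<gamma> = (a, b; c, d)\<close> with \<open>c > 0\<close>.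
  The fixed point of \<open>M\<gamma>\<close> is a root of \<open>c z\<^sup>2 + B z + C\<close> with \<open>B = d - y a - x c\<close> and
  \<open>C = - (y b + x d)\<close>, so it lies in \<open>\<F>\<^sup>-\<close> iff \<open>0 \<le> B \<le> c \<le> C\<close>. For fixed \<open>y > 1\<close> these conditions
  are linear in \<open>x\<close> and cut out an interval \<open>[l, r]\<close>. Multiplying \<open>\<gamma>\<close> on the right by
  \<open>T = (1, 1; 0, 1)\<close> or \<open>S = (0, -1; 1, 0)\<close> matches the right end point of every interval with the left
  end point of another one, hence the number of intervals that contain \<open>x\<close> does not depend on \<open>x\<close>
  (end points being counted with weight \<open>1/2\<close>). At \<open>x = 0\<close> there are exactly two intervals,
  and they meet in an end point, so the number is \<open>1\<close>. The weights \<open>1/4\<close> and \<open>1/6\<close> at the corners \<open>i\<close>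
  and \<open>\<rho>\<^sup>2\<close> differ from these weights, but the differences cancel over the orbits of the stabilisers of
  order 2 and 3. For \<open>y \<le> 1\<close> only finitely many explicit \<open>\<gamma>\<close> contribute.
\<close>

subsection \<open>Local densities of the half fundamental domain\<close>

text \<open>The two measures agree on open boxes, and this determines \<open>lborel\<close>. The
  identification carries rotation invariance from \<open>real^2\<close> over to
  \<open>complex\<close>.\<close>

lemma distr_lborel_Complex: "distr lborel borel (\<lambda>v::real^2. Complex (v$1) (v$2)) = lborel"
proof (rule lborel_eqI [symmetric])
  fix l u :: complex
  assume le: "\<And>b. b \<in> Basis \<Longrightarrow> l \<bullet> b \<le> u \<bullet> b"
  have lu: "Re l \<le> Re u" "Im l \<le> Im u"
    using le[of 1] le[of \<i>] by (auto simp: Basis_complex_def)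
  have meas: "(\<lambda>v::real^2. Complex (v$1) (v$2)) \<in> borel_measurable borel"
    by (intro borel_measurable_continuous_onI)
      (auto simp: Complex_eq intro!: continuous_intros)
  have vim: "(\<lambda>v::real^2. Complex (v$1) (v$2)) -` box l u =
      box (vector [Re l, Im l]) (vector [Re u, Im u])"
    by (auto simp: mem_box_cart forall_2 in_box_complex_iff)
  have "emeasure (distr lborel borel (\<lambda>v::real^2. Complex (v$1) (v$2))) (box l u)
      = emeasure lborel (box (vector [Re l, Im l]) (vector [Re u, Im u]) :: (real^2) set)"
    using meas by (subst emeasure_distr) (auto simp: vim)
  also have "\<dots> = ennreal (measure lborel (cbox (vector [Re l, Im l]) (vector [Re u, Im u]) :: (real^2) set))"
    by (subst emeasure_eq_ennreal_measure[symmetric])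
      (auto simp: emeasure_lborel_box_eq emeasure_lborel_cbox_eq)
  also have "measure lborel (cbox (vector [Re l, Im l]) (vector [Re u, Im u]) :: (real^2) set) = (\<Prod>b\<in>Basis. (u - l) \<bullet> b)"
    using lu by (subst content_cbox_cart) (auto simp: interval_ne_empty_cart forall_2 Basis_complex_def prod.insert UNIV_2)
  finally show "emeasure (distr lborel borel (\<lambda>v::real^2. Complex (v$1) (v$2))) (box l u)
      = ennreal (\<Prod>b\<in>Basis. (u - l) \<bullet> b)" .
qed simp

text \<open>In the coordinates of \<open>real^2\<close>, multiplication by a unit number is linear
  and preserves the norm. It is therefore an orthogonal transformation, and these leave Lebesgue
  measure invariant.\<close>

lemma measure_lborel_rotate:
  fixes u :: complex and S :: "complex set"
  assumes u: "norm u = 1" and S: "S \<in> sets borel" "bounded S"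
  shows "measure lborel ((*) u ` S) = measure lborel S"
proof -
  define f :: "real^2 \<Rightarrow> complex" where "f = (\<lambda>v. Complex (v$1) (v$2))"
  define g :: "complex \<Rightarrow> real^2" where "g = (\<lambda>z. vector [Re z, Im z])"
  have fg [simp]: "f (g z) = z" "g (f v) = v" for z v
    by (auto simp: f_def g_def vec_eq_iff forall_2)
  have f_meas [measurable]: "f \<in> borel_measurable borel"
    unfolding f_def by (intro borel_measurable_continuous_onI)
      (auto simp: Complex_eq intro!: continuous_intros)
  have norm_f: "norm (f v) = norm v" for v
    by (simp add: f_def norm_vec_def L2_set_def cmod_def sum_2)
  have meas: "measure lborel (f -` T) = measure lborel T" "f -` T \<in> sets borel" if "T \<in> sets borel" for T
  proof -
    show "f -` T \<in> sets borel"
      using measurable_sets[OF f_meas that] by simp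
    have "measure lborel T = measure (distr lborel borel f) T"
      using distr_lborel_Complex by (simp add: f_def)
    also have "\<dots> = measure lborel (f -` T)"
      using that by (subst measure_distr) auto
    finally show "measure lborel (f -` T) = measure lborel T" ..
  qed
  have u0: "u \<noteq> 0" using u by auto
  have uS: "(*) u ` S = (\<lambda>z. z / u) -` S"
    using u0 by (force simp: image_iff field_simps)
  have uS_meas: "(*) u ` S \<in> sets borel"
  proof -
    have "(\<lambda>z. z / u) \<in> borel_measurable borel"
      using u0 by (intro borel_measurable_continuous_onI continuous_intros) auto
    from measurable_sets[OF this S(1)] show ?thesis by (simp add: uS)
  qed
  define h where "h = (\<lambda>v. g (u * f v))"
  have "linear h"
    by (rule linearI)
      (auto simp: h_def g_def f_def vec_eq_iff forall_2 algebra_simps)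
  moreover have "norm (h v) = norm v" for v
    by (subst norm_f[symmetric]) (simp add: h_def norm_mult u norm_f)
  ultimately have h: "orthogonal_transformation h"
    by (simp add: orthogonal_transformation)
  have eq: "f -` ((*) u ` S) = h ` (f -` S)"
  proof -
    have "v \<in> h ` (f -` S)" if "f v = u * s" "s \<in> S" for v s
      using that by (intro image_eqI[of _ _ "g s"]) (auto simp: h_def simp flip: that(1))
    then show ?thesis by (auto simp: h_def)
  qed
  have "bounded (f -` S)"
    using S(2) by (simp add: bounded_iff Ball_def flip: norm_f) blast
  then have lm: "f -` S \<in> lmeasurable"
    using meas(2)[OF S(1)] by (intro bounded_set_imp_lmeasurable) auto
  have "measure lborel ((*) u ` S) = measure lborel (h ` (f -` S))"
    by (simp add: meas(1)[OF uS_meas, symmetric] eq)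
  also have "\<dots> = measure lebesgue (h ` (f -` S))"
    using meas(2)[OF uS_meas] by (simp add: eq)
  also have "\<dots> = measure lebesgue (f -` S)"
    by (rule measure_orthogonal_image[OF h lm])
  also have "\<dots> = measure lborel S"
    using meas[OF S(1)] by simp
  finally show ?thesis .
qed

text \<open>The substitution \<open>w -> z + r w\<close> scales area by \<open>r^2\<close>. The
  shrinking disc is thus replaced by a fixed unit disc, and only the set inside it varies with
  \<open>r\<close>.\<close>

lemma measure_lborel_ball_affine:
  fixes z :: complex
  assumes r: "r > 0" and F: "F \<in> sets borel"
  shows "measure lborel (ball z r \<inter> F) = r\<^sup>2 * measure lborel {w \<in> ball 0 1. z + of_real r * w \<in> F}"
proof -
  have m: "(\<lambda>x. z + r *\<^sub>R x) \<in> borel_measurable borel"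
    by (intro borel_measurable_continuous_onI continuous_intros)
  have B: "ball z r \<inter> F \<in> sets borel" using F by auto
  have vim: "(\<lambda>x. z + r *\<^sub>R x) -` (ball z r \<inter> F) = {w \<in> ball 0 1. z + of_real r * w \<in> F}"
    using r by (auto simp: dist_norm norm_mult scaleR_conv_of_real)
  have "emeasure lborel (ball z r \<inter> F) =
      emeasure (density (distr lborel borel (\<lambda>x. z + r *\<^sub>R x)) (\<lambda>_. \<bar>r\<bar>^DIM(complex))) (ball z r \<inter> F)"
    using lborel_affine[of r z] r by simp
  also have "\<dots> = ennreal (r\<^sup>2) * emeasure lborel {w \<in> ball 0 1. z + of_real r * w \<in> F}"
    using B m r by (simp add: emeasure_density nn_integral_cmult emeasure_distr vim del: vimage_Int)
  finally show ?thesis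
    by (simp add: measure_def enn2real_mult)
qed

section \<open>The density of \<open>F_minus\<close> at a point as the area of a tangent
  cone\<close>

text \<open>After rescaling, the area fraction is the area of \<open>S r\<close> divided by
  \<open>pi\<close>, and dominated convergence applies once the indicators converge off a null set.
  \<open>N\<close> is meant for the directions tangent to a boundary curve, where second-order terms
  decide.\<close>

lemma chi_minus_eqI:
  fixes K :: "complex set"
  assumes K: "K \<in> sets borel" and N: "negligible N"
    and ev: "\<And>w. norm w < 1 \<Longrightarrow> w \<notin> N \<Longrightarrow>
      \<forall>\<^sub>F r in at_right 0. z + of_real r * w \<in> F_minus \<longleftrightarrow> w \<in> K"
  shows "chi_minus z = measure lborel (ball 0 1 \<inter> K) / pi"
proof -
  have F: "F_minus \<in> sets borel"
  proof -
    have "F_minus = {w. Im w > 0} \<inter> {w. - (1/2) \<le> Re w} \<inter> {w. Re w \<le> 0} \<inter> {w. norm w \<ge> 1}"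
      by (auto simp: F_minus_def upper_half_plane_def)
    also have "\<dots> \<in> sets borel"
      by (intro sets.Int borel_open borel_closed open_Collect_less closed_Collect_le continuous_intros)
    finally show ?thesis .
  qed
  define S where "S = (\<lambda>r. {w \<in> ball 0 1. z + of_real r * w \<in> F_minus})"
  have S_meas [measurable]: "S r \<in> sets borel" for r
  proof -
    have m: "(\<lambda>w. z + of_real r * w) \<in> borel_measurable borel"
      by (intro borel_measurable_continuous_onI continuous_intros)
    have "S r = ball 0 1 \<inter> (\<lambda>w. z + of_real r * w) -` F_minus" by (auto simp: S_def)
    then show ?thesis using measurable_sets[OF m F] by auto
  qed
  have lim: "((\<lambda>r. measure lborel (S r)) \<longlongrightarrow> measure lborel (ball 0 1 \<inter> K)) (at_right 0)"
  proof (rule tendsto_at_right_sequentially[of 0 1])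
    fix s :: "nat \<Rightarrow> real"
    assume s: "\<And>n. 0 < s n" "s \<longlonglongrightarrow> 0"
    then have fl: "filterlim s (at_right 0) sequentially"
      by (auto simp: filterlim_at less_imp_neq[THEN not_sym])
    have "(\<lambda>n. integral\<^sup>L lebesgue (indicat_real (S (s n)))) \<longlonglongrightarrow> integral\<^sup>L lebesgue (indicat_real (ball 0 1 \<inter> K))"
    proof (rule integral_dominated_convergence[where w = "indicat_real (ball 0 1)"])
      show "AE w in lebesgue. (\<lambda>n. indicat_real (S (s n)) w) \<longlonglongrightarrow> indicat_real (ball 0 1 \<inter> K) w"
      proof (rule AE_I')
        show "N \<in> null_sets lebesgue" using N by (simp add: negligible_iff_null_sets)
        have "(\<lambda>n. indicat_real (S (s n)) w) \<longlonglongrightarrow> indicat_real (ball 0 1 \<inter> K) w" if "w \<notin> N" for w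
        proof (cases "norm w < 1")
          case True
          have "\<forall>\<^sub>F n in sequentially. z + of_real (s n) * w \<in> F_minus \<longleftrightarrow> w \<in> K"
            using filterlim_iff[THEN iffD1, OF fl] ev[OF True that] by blast
          then show ?thesis
            by (intro tendsto_eventually) (auto elim!: eventually_mono simp: S_def True indicator_def)
        qed (simp add: S_def)
        then show "{w \<in> space lebesgue. \<not> (\<lambda>n. indicat_real (S (s n)) w) \<longlonglongrightarrow> indicat_real (ball 0 1 \<inter> K) w} \<subseteq> N"
          by auto
      qed
      show "integrable lebesgue (indicat_real (ball 0 1 :: complex set))"
        using emeasure_bounded_finite[OF bounded_ball[of "0::complex" 1]]
        by (simp add: integrable_indicator_iff less_top)
      show "AE x in lebesgue. norm (indicat_real (S (s n)) x) \<le> indicat_real (ball 0 1) x" for n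
        by (auto simp: S_def indicator_def)
    qed (use K S_meas in \<open>auto intro!: borel_measurable_indicator\<close>)
    then show "(\<lambda>n. measure lborel (S (s n))) \<longlonglongrightarrow> measure lborel (ball 0 1 \<inter> K)"
      using K S_meas by simp
  qed simp
  have "((\<lambda>r. measure lborel (ball z r \<inter> F_minus) / measure lborel (ball z r)) \<longlongrightarrow>
      measure lborel (ball 0 1 \<inter> K) / pi) (at_right 0)"
  proof (rule Lim_transform_eventually)
    show "((\<lambda>r. measure lborel (S r) / pi) \<longlongrightarrow> measure lborel (ball 0 1 \<inter> K) / pi) (at_right 0)"
      by (intro tendsto_intros lim) simp
    show "\<forall>\<^sub>F r in at_right 0. measure lborel (S r) / pi =
        measure lborel (ball z r \<inter> F_minus) / measure lborel (ball z r)"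
      using eventually_at_right_less[of "0::real"]
    proof eventually_elim
      case (elim r)
      then show ?case
        by (simp add: measure_lborel_ball_affine[OF _ F] S_def content_ball unit_ball_vol_2)
    qed
  qed
  then show ?thesis
    unfolding chi_minus_def by (intro tendsto_Lim) auto
qed

text \<open>To the right of \<open>0\<close> the first nonvanishing coefficient decides the
  sign.\<close>

lemma eventually_quadratic_pos:
  fixes a b c :: real
  assumes "a > 0 \<or> a = 0 \<and> b > 0"
  shows "\<forall>\<^sub>F r in at_right 0. a + b * r + c * r\<^sup>2 > 0"
proof -
  consider "a > 0" | "a = 0" "b > 0" using assms by auto
  then show ?thesis
  proof cases
    case 1
    have "((\<lambda>r. a + b * r + c * r\<^sup>2) \<longlongrightarrow> a + b * 0 + c * 0\<^sup>2) (at_right 0)"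
      by (intro tendsto_intros)
    then show ?thesis using 1 by (intro order_tendstoD(1)) auto
  next
    case 2
    have "((\<lambda>r. b + c * r) \<longlongrightarrow> b + c * 0) (at_right 0)"
      by (intro tendsto_intros)
    then have "\<forall>\<^sub>F r in at_right 0. b + c * r > 0"
      using 2 by (intro order_tendstoD(1)) auto
    then show ?thesis
      using eventually_at_right_less[of "0::real"]
    proof eventually_elim
      case (elim r)
      then have "r * (b + c * r) > 0" by simp
      then show ?case using 2 by (simp add: algebra_simps power2_eq_square)
    qed
  qed
qed

text \<open>Squaring the norm makes all conditions polynomial in \<open>r\<close>. The vanishing
  quadratic terms are written out so that each condition has the shape treated in
  \<open>eventually_quadratic_pos\<close>.\<close>

lemma F_minus_shift:
  "z + of_real r * w \<in> F_minus \<longleftrightarrow>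
     Im z + Im w * r + 0 * r\<^sup>2 > 0 \<and> 1/2 + Re z + Re w * r + 0 * r\<^sup>2 \<ge> 0 \<and> - Re z + (- Re w) * r + 0 * r\<^sup>2 \<ge> 0 \<and>
     ((norm z)\<^sup>2 - 1) + 2 * (z \<bullet> w) * r + (norm w)\<^sup>2 * r\<^sup>2 \<ge> 0"
proof -
  have "1 \<le> norm (z + of_real r * w) \<longleftrightarrow> 1\<^sup>2 \<le> (norm (z + of_real r * w))\<^sup>2"
    by (rule power_mono_iff[symmetric]) auto
  also have "(norm (z + of_real r * w))\<^sup>2 = (norm z)\<^sup>2 + 2 * (z \<bullet> w) * r + (norm w)\<^sup>2 * r\<^sup>2"
    unfolding cmod_power2 by (simp add: inner_complex_def power2_eq_square algebra_simps)
  finally show ?thesis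
    by (auto simp: F_minus_def upper_half_plane_def mult.commute)
qed

lemma negligible_zero_Re: "negligible {w. Re w = 0}"
  using negligible_hyperplane[of "1::complex" 0] by (simp add: inner_complex_def)

lemma negligible_inner_zero: "z \<noteq> 0 \<Longrightarrow> negligible {w. z \<bullet> w = 0}" for z :: complex
  using negligible_hyperplane[of z 0] by simp

text \<open>An inequality that is strict at \<open>z\<close> persists along every ray. One that is
  an equality at \<open>z\<close> is decided by its linear term, except for the negligible set of
  directions where that term vanishes.\<close>

lemma chi_minus_tangent_cone:
  assumes z: "z \<in> F_minus"
  shows "chi_minus z = measure lborel (ball 0 1 \<inter>
    {w. (Re z = - 1/2 \<longrightarrow> Re w \<ge> 0) \<and> (Re z = 0 \<longrightarrow> Re w \<le> 0) \<and> (norm z = 1 \<longrightarrow> z \<bullet> w \<ge> 0)}) / pi"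
    (is "_ = measure lborel (ball 0 1 \<inter> ?K) / pi")
proof (rule chi_minus_eqI)
  have z': "Im z > 0" "Re z \<ge> - 1/2" "Re z \<le> 0" "norm z \<ge> 1"
    using z by (auto simp: F_minus_def upper_half_plane_def)
  then have "(norm z)\<^sup>2 \<ge> 1" by (simp add: one_le_power)
  have nz1: "(norm z)\<^sup>2 = 1 \<longleftrightarrow> norm z = 1"
    using z'(4) by (auto simp: power2_eq_1_iff)
  have "?K = (if Re z = - 1/2 then {w. Re w \<ge> 0} else UNIV) \<inter> (if Re z = 0 then {w. Re w \<le> 0} else UNIV)
      \<inter> (if norm z = 1 then {w. z \<bullet> w \<ge> 0} else UNIV)" by auto
  moreover have "closed \<dots>"
    by (intro closed_Int) (auto intro!: closed_Collect_le continuous_intros)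
  ultimately show "?K \<in> sets borel" by simp
  have "z \<noteq> 0" using z' by auto
  then show "negligible ({w. Re w = 0} \<union> {w. z \<bullet> w = 0})"
    using negligible_zero_Re negligible_inner_zero by auto
  fix w assume w: "w \<notin> {w. Re w = 0} \<union> {w. z \<bullet> w = 0}"
  have ev: "\<forall>\<^sub>F r in at_right 0. (a + b * r + c * r\<^sup>2 \<ge> 0 \<longleftrightarrow> (a = 0 \<longrightarrow> b \<ge> 0))"
    if "a \<ge> 0" "b \<noteq> 0" for a b c :: real
  proof (cases "a > 0 \<or> b > 0")
    case True
    with that have "\<forall>\<^sub>F r in at_right 0. a + b * r + c * r\<^sup>2 > 0"
      by (intro eventually_quadratic_pos) auto
    then show ?thesis using True by (auto elim!: eventually_mono)
  next
    case False
    with that have "\<forall>\<^sub>F r in at_right 0. (-a) + (-b) * r + (-c) * r\<^sup>2 > 0"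
      by (intro eventually_quadratic_pos) auto
    then show ?thesis using False that by (auto elim!: eventually_mono)
  qed
  show "\<forall>\<^sub>F r in at_right 0. z + of_real r * w \<in> F_minus \<longleftrightarrow> w \<in> ?K"
  proof -
    have "\<forall>\<^sub>F r in at_right 0. Im z + Im w * r + 0 * r\<^sup>2 > 0"
      by (rule eventually_quadratic_pos) (use z' in auto)
    moreover have "\<forall>\<^sub>F r in at_right 0. 1/2 + Re z + Re w * r + 0 * r\<^sup>2 \<ge> 0 \<longleftrightarrow> (1/2 + Re z = 0 \<longrightarrow> Re w \<ge> 0)"
      by (rule ev) (use z' w in auto)
    moreover have "\<forall>\<^sub>F r in at_right 0. - Re z + (- Re w) * r + 0 * r\<^sup>2 \<ge> 0 \<longleftrightarrow> (- Re z = 0 \<longrightarrow> - Re w \<ge> 0)"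
      by (rule ev) (use z' w in auto)
    moreover have "\<forall>\<^sub>F r in at_right 0. ((norm z)\<^sup>2 - 1) + 2 * (z \<bullet> w) * r + (norm w)\<^sup>2 * r\<^sup>2 \<ge> 0
        \<longleftrightarrow> ((norm z)\<^sup>2 - 1 = 0 \<longrightarrow> 2 * (z \<bullet> w) \<ge> 0)"
      by (rule ev) (use \<open>(norm z)\<^sup>2 \<ge> 1\<close> w in auto)
    ultimately show ?thesis
    proof eventually_elim
      case (elim r)
      have iffs: "Re z = - 1/2 \<longleftrightarrow> 1/2 + Re z = 0" "Re z = 0 \<longleftrightarrow> - Re z = 0" "Re w \<le> 0 \<longleftrightarrow> - Re w \<ge> 0"
        "norm z = 1 \<longleftrightarrow> (norm z)\<^sup>2 - 1 = 0" "z \<bullet> w \<ge> 0 \<longleftrightarrow> 2 * (z \<bullet> w) \<ge> 0"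
        using nz1 by auto
      show ?case unfolding F_minus_shift mem_Collect_eq iffs using elim by blast
    qed
  qed
qed

text \<open>A violated inequality is violated strictly, hence also near \<open>z\<close>, so the
  cone is empty.\<close>

lemma chi_minus_outside:
  assumes "Im z > 0" "z \<notin> F_minus"
  shows "chi_minus z = 0"
proof -
  have "(norm z)\<^sup>2 < 1 \<or> Re z < - 1/2 \<or> Re z > 0"
    using assms by (auto simp: F_minus_def upper_half_plane_def power_less_one_iff abs_square_less_1)
  then have ev: "\<forall>\<^sub>F r in at_right 0. z + of_real r * w \<notin> F_minus" for w
    using eventually_quadratic_pos[of "1 - (norm z)\<^sup>2" "- (2 * (z \<bullet> w))" "- (norm w)\<^sup>2"]
      eventually_quadratic_pos[of "- 1/2 - Re z" "- Re w" 0]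
      eventually_quadratic_pos[of "Re z" "Re w" 0]
    unfolding F_minus_shift by (auto elim!: eventually_mono)
  show ?thesis
    using chi_minus_eqI[of "{}" "{}" z] ev by simp
qed

section \<open>Areas of disc sectors\<close>

lemma measure_Un_negligible_Int:
  fixes S T :: "complex set"
  assumes "S \<in> sets borel" "T \<in> sets borel" "bounded S" "bounded T" "negligible (S \<inter> T)"
  shows "measure lborel (S \<union> T) = measure lborel S + measure lborel T"
proof -
  have lm: "S \<in> lmeasurable" "T \<in> lmeasurable"
    using assms by (auto intro!: bounded_set_imp_lmeasurable)
  have "measure lebesgue (S \<union> T \<union> {}) = measure lebesgue S + measure lebesgue T + measure lebesgue ({}::complex set)"
    by (rule measure_Un3_negligible[OF lm _ _ _ _ refl]) (use assms(5) in auto)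
  then show ?thesis
    using assms(1,2) by simp
qed

text \<open>Since \<open>v\<close> is the inverse of \<open>u\<close>, a rotated region is described
  by substituting \<open>v * w\<close> into its condition. Coverings by rotated sectors then reduce
  to inequalities.\<close>

lemma rotate_ball_Int:
  fixes u v :: complex
  assumes "norm u = 1" "u * v = 1"
  shows "(*) u ` (ball 0 1 \<inter> {w. P w}) = ball 0 1 \<inter> {w. P (v * w)}"
proof -
  have nv: "norm v = 1" using assms by (metis mult_1 norm_mult norm_one)
  have uvw: "u * (v * w) = w" "v * (u * w) = w" for w
    using assms(2) by (simp_all add: mult.assoc[symmetric] mult.commute[of v u])
  show ?thesis
  proof (intro equalityI subsetI)
    fix w assume "w \<in> ball 0 1 \<inter> {w. P (v * w)}"
    then have "v * w \<in> ball 0 1 \<inter> {w. P w}" by (simp add: norm_mult nv)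
    then show "w \<in> (*) u ` (ball 0 1 \<inter> {w. P w})"
      by (rule rev_image_eqI) (simp add: uvw)
  qed (auto simp: norm_mult assms uvw)
qed

text \<open>The half disc and its image under \<open>-1\<close> cover the disc and meet in a
  diameter.\<close>

lemma measure_half_disc:
  fixes z :: complex
  assumes "z \<noteq> 0"
  shows "measure lborel (ball 0 1 \<inter> {w. z \<bullet> w \<ge> 0}) = pi / 2"
proof -
  let ?D = "ball 0 1 \<inter> {w. z \<bullet> w \<ge> 0}"
  have D: "?D \<in> sets borel"
    by (intro sets.Int borel_closed[OF closed_Collect_le] borel_open[OF open_ball] continuous_intros)
  have rot: "(*) (-1) ` ?D = ball 0 1 \<inter> {w. z \<bullet> (-1 * w) \<ge> 0}"
    by (rule rotate_ball_Int) auto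
  have un: "?D \<union> (*) (-1) ` ?D = ball 0 1"
    unfolding rot by auto
  have D': "(*) (-1) ` ?D \<in> sets borel"
    unfolding rot
    by (intro sets.Int borel_closed[OF closed_Collect_le] borel_open[OF open_ball] continuous_intros)
  have "measure lborel (?D \<union> (*) (-1) ` ?D) = measure lborel ?D + measure lborel ((*) (-1) ` ?D)"
  proof (rule measure_Un_negligible_Int[OF D D'])
    show "negligible (?D \<inter> (*) (-1) ` ?D)"
      by (rule negligible_subset[OF negligible_inner_zero[OF assms]]) (auto simp: rot)
    show "bounded ((*) (-1) ` ?D)" unfolding rot by auto
  qed auto
  also have "measure lborel ((*) (-1) ` ?D) = measure lborel ?D"
    by (rule measure_lborel_rotate[OF _ D]) auto
  finally show ?thesis
    unfolding un by (simp add: content_ball unit_ball_vol_2)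
qed

text \<open>This sector is the tangent cone at \<open>i\<close>. It and its image under
  multiplication by \<open>-i\<close> tile the upper half disc.\<close>

lemma measure_quarter_disc:
  "measure lborel (ball 0 1 \<inter> {w. Re w \<le> 0 \<and> Im w \<ge> 0}) = pi / 4"
proof -
  let ?D = "ball 0 1 \<inter> {w. Re w \<le> 0 \<and> Im w \<ge> 0}"
  have closed: "closed {w. Re w \<le> 0 \<and> Im w \<ge> 0}" "closed {w. Re w \<ge> 0 \<and> Im w \<ge> 0}"
    unfolding Collect_conj_eq by (intro closed_Int closed_Collect_le continuous_intros)+
  have D: "?D \<in> sets borel"
    by (intro sets.Int borel_closed closed borel_open open_ball)
  have rot: "(*) (-\<i>) ` ?D = ball 0 1 \<inter> {w. Re w \<ge> 0 \<and> Im w \<ge> 0}"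
    by (subst rotate_ball_Int[of _ \<i>]) auto
  have D': "(*) (-\<i>) ` ?D \<in> sets borel"
    unfolding rot by (intro sets.Int borel_closed closed borel_open open_ball)
  have "measure lborel (?D \<union> (*) (-\<i>) ` ?D) = measure lborel ?D + measure lborel ((*) (-\<i>) ` ?D)"
  proof (rule measure_Un_negligible_Int[OF D D'])
    show "negligible (?D \<inter> (*) (-\<i>) ` ?D)"
      by (rule negligible_subset[OF negligible_zero_Re]) (auto simp: rot)
    show "bounded ((*) (-\<i>) ` ?D)" unfolding rot by auto
  qed auto
  also have "measure lborel ((*) (-\<i>) ` ?D) = measure lborel ?D"
    by (rule measure_lborel_rotate[OF _ D]) auto
  also have "?D \<union> (*) (-\<i>) ` ?D = ball 0 1 \<inter> {w. \<i> \<bullet> w \<ge> 0}"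
    unfolding rot by (auto simp: inner_complex_def)
  finally show ?thesis
    by (subst (asm) measure_half_disc) auto
qed

text \<open>This sector, with arguments from \<open>pi/6\<close> to \<open>pi/2\<close>, is the
  tangent cone at \<open>rho^2\<close>. With \<open>u\<close> the rotation by \<open>-pi/3\<close>,
  its images under \<open>1\<close>, \<open>u\<close> and \<open>u^2\<close> tile the right half
  disc.\<close>

lemma measure_sixth_disc:
  "measure lborel (ball 0 1 \<inter> {w. Re w \<ge> 0 \<and> sqrt 3 * Im w \<ge> Re w}) = pi / 6"
proof -
  let ?D = "ball 0 1 \<inter> {w. Re w \<ge> 0 \<and> sqrt 3 * Im w \<ge> Re w}"
  define u where "u = Complex (1/2) (- sqrt 3 / 2)"
  define v where "v = Complex (1/2) (sqrt 3 / 2)"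
  have uv: "norm u = 1" "u * v = 1"
    by (auto simp: u_def v_def cmod_def power2_eq_square complex_eq_iff)
  have nn: "norm (u\<^sup>2) = 1" "u\<^sup>2 * v\<^sup>2 = 1"
    using uv by (auto simp: norm_power simp flip: power_mult_distrib)
  have v2: "v\<^sup>2 = Complex (- 1/2) (sqrt 3 / 2)"
    by (auto simp: v_def complex_eq_iff power2_eq_square)
  have rot1: "(*) u ` ?D = ball 0 1 \<inter> {w. - Re w \<le> sqrt 3 * Im w \<and> sqrt 3 * Im w \<le> Re w}"
    by (subst rotate_ball_Int[OF uv]) (auto simp: v_def algebra_simps)
  have rot2: "(*) (u\<^sup>2) ` ?D = ball 0 1 \<inter> {w. Re w \<ge> 0 \<and> sqrt 3 * Im w \<le> - Re w}"
    by (subst rotate_ball_Int[OF nn]) (auto simp: v2 algebra_simps)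
  have closed: "closed {w. Re w \<ge> 0 \<and> sqrt 3 * Im w \<ge> Re w}"
      "closed {w. - Re w \<le> sqrt 3 * Im w \<and> sqrt 3 * Im w \<le> Re w}"
      "closed {w. Re w \<ge> 0 \<and> sqrt 3 * Im w \<le> - Re w}"
    unfolding Collect_conj_eq by (intro closed_Int closed_Collect_le continuous_intros)+
  have D: "?D \<in> sets borel"
    by (intro sets.Int borel_closed closed borel_open open_ball)
  have "measure lebesgue (?D \<union> (*) u ` ?D \<union> (*) (u\<^sup>2) ` ?D) =
      measure lebesgue ?D + measure lebesgue ((*) u ` ?D) + measure lebesgue ((*) (u\<^sup>2) ` ?D)"
    unfolding rot1 rot2
  proof (rule measure_Un3_negligible[OF _ _ _ _ _ _ refl])
    have N1: "negligible {w. Complex (-1) (sqrt 3) \<bullet> w = 0}" and N2: "negligible {w. Complex 1 (sqrt 3) \<bullet> w = 0}"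
      by (rule negligible_inner_zero, simp add: complex_eq_iff)+
    show "negligible (?D \<inter> (ball 0 1 \<inter> {w. - Re w \<le> sqrt 3 * Im w \<and> sqrt 3 * Im w \<le> Re w}))"
      by (rule negligible_subset[OF N1]) (auto simp: inner_complex_def)
    show "negligible (?D \<inter> (ball 0 1 \<inter> {w. Re w \<ge> 0 \<and> sqrt 3 * Im w \<le> - Re w}))"
      by (rule negligible_subset[OF negligible_zero_Re]) auto
    show "negligible (ball 0 1 \<inter> {w. - Re w \<le> sqrt 3 * Im w \<and> sqrt 3 * Im w \<le> Re w}
        \<inter> (ball 0 1 \<inter> {w. Re w \<ge> 0 \<and> sqrt 3 * Im w \<le> - Re w}))"
      by (rule negligible_subset[OF N2]) (auto simp: inner_complex_def)
  qed (use closed in \<open>auto intro!: bounded_set_imp_lmeasurable bounded_Int\<close>)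
  moreover have "?D \<union> (*) u ` ?D \<union> (*) (u\<^sup>2) ` ?D = ball 0 1 \<inter> {w. 1 \<bullet> w \<ge> 0}"
    unfolding rot1 rot2 by (auto simp: inner_complex_def)
  moreover have "measure lborel ((*) u ` ?D) = measure lborel ?D"
    "measure lborel ((*) (u\<^sup>2) ` ?D) = measure lborel ?D"
    using measure_lborel_rotate[OF uv(1) D] measure_lborel_rotate[OF nn(1) D] by auto
  moreover have "closed {w::complex. 1 \<bullet> w \<ge> 0}"
    by (intro closed_Collect_le continuous_intros)
  ultimately have "3 * measure lborel ?D = measure lborel (ball 0 1 \<inter> {w::complex. 1 \<bullet> w \<ge> 0})"
    using D closed rot1 rot2 by simp
  then show ?thesis by (subst (asm) measure_half_disc) auto
qed

lemma chi_minus_eq: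
  assumes "Im z > 0"
  shows "chi_minus z =
    (if z \<notin> F_minus then 0
     else if norm z = 1 then (if Re z = 0 then 1/4 else if Re z = - 1/2 then 1/6 else 1/2)
     else if Re z = 0 \<or> Re z = - 1/2 then 1/2 else 1)"
proof (cases "z \<in> F_minus")
  case False
  then show ?thesis using chi_minus_outside[OF assms] by simp
next
  case True
  note chi = chi_minus_tangent_cone[OF True]
  have z0: "z \<noteq> 0" using assms by auto
  consider "norm z = 1" "Re z = 0" | "norm z = 1" "Re z = - 1/2"
    | "norm z = 1" "Re z \<noteq> 0" "Re z \<noteq> - 1/2"
    | "norm z \<noteq> 1" "Re z = 0" | "norm z \<noteq> 1" "Re z = - 1/2"
    | "norm z \<noteq> 1" "Re z \<noteq> 0" "Re z \<noteq> - 1/2" by blast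
  then show ?thesis
  proof cases
    case 1
    then have "Im z = 1" using assms by (simp add: cmod_def)
    then show ?thesis using 1 True chi measure_quarter_disc by (simp add: inner_complex_def)
  next
    case 2
    then have "(Im z)\<^sup>2 = 3/4" using cmod_power2[of z] by (simp add: power2_eq_square)
    then have "sqrt (3/4) = Im z" using assms by (intro real_sqrt_unique) auto
    then have "Im z = sqrt 3 / 2" by (simp add: real_sqrt_divide)
    then have "2 * (z \<bullet> w) = sqrt 3 * Im w - Re w" for w
      using 2(2) by (simp add: inner_complex_def)
    then have "z \<bullet> w \<ge> 0 \<longleftrightarrow> sqrt 3 * Im w \<ge> Re w" for w
      by (smt (verit))
    then show ?thesis using 2 True chi measure_sixth_disc by simp
  next
    case 3
    then show ?thesis using True chi measure_half_disc[OF z0] by simp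
  next
    case 4
    then show ?thesis using True chi measure_half_disc[of "-1"] by (simp add: inner_complex_def)
  next
    case 5
    then show ?thesis using True chi measure_half_disc[of 1] by (simp add: inner_complex_def)
  next
    case 6
    then show ?thesis using True chi by (simp add: content_ball unit_ball_vol_2)
  qed
qed

text \<open>The value of \<open>\<chi>\<^sup>-\<close> at the root of \<open>A z\<^sup>2 + B z + C\<close> in the upper half-plane, where \<open>E = C - A\<close>.\<close>

definition cone_weight :: "real \<Rightarrow> real \<Rightarrow> real \<Rightarrow> real" where
  "cone_weight A B E =
    (if B < 0 \<or> A < B \<or> E < 0 then 0
     else if E = 0 then (if B = 0 then 1/4 else if B = A then 1/6 else 1/2)
     else if B = 0 \<or> B = A then 1/2 else 1)"

section \<open>The fixed point and \<alpha> in terms of the matrix entries\<close>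

text \<open>Clearing the denominator gives a real quadratic equation. As \<open>w\<close> is not
  real, its roots are \<open>w\<close> and the conjugate of \<open>w\<close>, and the right-hand
  side states their sum and product.\<close>

lemma mobius_fixed_iff:
  fixes N :: "real^2^2"
  assumes c: "N$2$1 > 0" and w: "Im w > 0"
  shows "mobius N w = w \<longleftrightarrow>
    Re w = - (N$2$2 - N$1$1) / (2 * N$2$1) \<and> (norm w)\<^sup>2 = - N$1$2 / N$2$1"
proof -
  let ?A = "N$2$1" and ?B = "N$2$2 - N$1$1" and ?C = "- N$1$2"
  \<comment> \<open>Substituting \<open>b = - 2 a p\<close> turns \<open>a (p^2 - q^2) + b p\<close>
    into \<open>- a (p^2 + q^2)\<close>.\<close>
  have aux: "a * (p\<^sup>2 - q\<^sup>2) + b * p + k = 0 \<and> b = - 2 * a * p \<longleftrightarrow> b = - 2 * a * p \<and> a * (p\<^sup>2 + q\<^sup>2) = k"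
    for a b k p q :: real
    by (auto simp: power2_eq_square algebra_simps)
  have "Im (of_real (N$2$1) * w + of_real (N$2$2)) \<noteq> 0" using c w by simp
  then have nz: "of_real (N$2$1) * w + of_real (N$2$2) \<noteq> 0" by (metis zero_complex.simps(2))
  have "mobius N w = w \<longleftrightarrow> of_real ?A * w\<^sup>2 + of_real ?B * w + of_real ?C = 0"
    using nz by (auto simp: mobius_def divide_eq_eq algebra_simps power2_eq_square)
  also have "\<dots> \<longleftrightarrow> ?A * ((Re w)\<^sup>2 - (Im w)\<^sup>2) + ?B * Re w + ?C = 0 \<and> Im w * (2 * ?A * Re w + ?B) = 0"
    by (auto simp: complex_eq_iff power2_eq_square algebra_simps)
  also have "\<dots> \<longleftrightarrow> ?A * ((Re w)\<^sup>2 - (Im w)\<^sup>2) + ?B * Re w + ?C = 0 \<and> ?B = - 2 * ?A * Re w"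
    using w by auto
  also have "\<dots> \<longleftrightarrow> ?B = - 2 * ?A * Re w \<and> ?A * ((Re w)\<^sup>2 + (Im w)\<^sup>2) = ?C"
    by (rule aux)
  also have "\<dots> \<longleftrightarrow> Re w = - ?B / (2 * ?A) \<and> (norm w)\<^sup>2 = ?C / ?A"
    unfolding cmod_power2 using c by (auto simp: field_simps)
  finally show ?thesis .
qed

text \<open>With \<open>Re z = - B / (2 A)\<close> and \<open>|z|^2 = C / A\<close>, the conditions
  for \<open>F_minus\<close> become \<open>0 \<le> B \<le> A \<le> C\<close>, and the corners are
  the cases of two equalities.\<close>

lemma alpha_eq_cone_weight:
  fixes N :: "real^2^2"
  assumes c: "N$2$1 > 0"
  shows "alpha N = cone_weight (N$2$1) (N$2$2 - N$1$1) (- N$1$2 - N$2$1)"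
proof -
  define A B C where "A = N$2$1" and "B = N$2$2 - N$1$1" and "C = - N$1$2"
  have A: "A > 0" using c by (simp add: A_def)
  have ell: "elliptic N \<longleftrightarrow> B\<^sup>2 < 4 * A * C"
    by (simp add: elliptic_def trace_def sum_2 det_2 A_def B_def C_def power2_eq_square algebra_simps)
  have "alpha N = cone_weight A B (C - A)"
  proof (cases "elliptic N")
    case False
    have "\<not> (\<exists>k. N = mat k)" using c by (auto simp: matrix_eq_2 mat_def)
    then have "alpha N = 0" using False by (simp add: alpha_def)
    \<comment> \<open>These inequalities give \<open>B^2 \<le> A^2 < 4 A C\<close>, so a nonzero
      weight occurs only for elliptic matrices.\<close>
    moreover have "\<not> (0 \<le> B \<and> B \<le> A \<and> C \<ge> A)"
    proof
      assume *: "0 \<le> B \<and> B \<le> A \<and> C \<ge> A"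
      then have "B\<^sup>2 \<le> A\<^sup>2" by (intro power_mono) auto
      also have "A\<^sup>2 < 4 * A * C" using * A by (simp add: power2_eq_square)
      finally show False using False ell by simp
    qed
    ultimately show ?thesis by (auto simp: cone_weight_def)
  next
    case True
    then have D: "C / A - (B / (2 * A))\<^sup>2 > 0"
      using A ell by (simp add: field_simps power2_eq_square)
    define z where "z = Complex (- B / (2 * A)) (sqrt (C / A - (B / (2 * A))\<^sup>2))"
    have z: "Im z > 0" "Re z = - B / (2 * A)" "(norm z)\<^sup>2 = C / A"
      using D unfolding cmod_power2 by (auto simp: z_def power_divide)
    have uniq: "w = z" if "Im w > 0" "Re w = - B / (2 * A)" "(norm w)\<^sup>2 = C / A" for w
    proof -
      have "Re w = Re z" "(norm w)\<^sup>2 = (norm z)\<^sup>2" using that z by auto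
      then have "(Im w)\<^sup>2 = (Im z)\<^sup>2" unfolding cmod_power2 by (metis add_left_imp_eq)
      then have "Im w = Im z" using that(1) z(1) by (simp add: power2_eq_iff_nonneg)
      then show ?thesis using that z by (simp add: complex_eq_iff)
    qed
    have "fixed_point N = z"
      unfolding fixed_point_def
    proof (rule the_equality)
      show "z \<in> upper_half_plane \<and> mobius N z = z"
        using z by (simp add: upper_half_plane_def mobius_fixed_iff[OF c] A_def B_def C_def)
      show "w = z" if "w \<in> upper_half_plane \<and> mobius N w = w" for w
      proof -
        have "Im w > 0" using that by (simp add: upper_half_plane_def)
        then show ?thesis
          using that mobius_fixed_iff[OF c, of w] by (intro uniq) (auto simp: A_def B_def C_def)
      qed
    qed
    then have "alpha N = chi_minus z" using True by (simp add: alpha_def)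
    moreover have "norm z \<ge> 1 \<longleftrightarrow> C \<ge> A" "norm z = 1 \<longleftrightarrow> C = A"
    proof -
      have "norm z \<ge> 1 \<longleftrightarrow> (norm z)\<^sup>2 \<ge> 1"
        using power_mono_iff[of 1 "norm z" 2] by simp
      then show "norm z \<ge> 1 \<longleftrightarrow> C \<ge> A" using z(3) A by simp
      have "norm z = 1 \<longleftrightarrow> (norm z)\<^sup>2 = 1"
        using power2_eq_iff_nonneg[of "norm z" 1] by simp
      then show "norm z = 1 \<longleftrightarrow> C = A" using z(3) A by (auto simp: field_simps)
    qed
    moreover have "Re z = 0 \<longleftrightarrow> B = 0" "Re z = - 1/2 \<longleftrightarrow> B = A" "Re z \<le> 0 \<longleftrightarrow> B \<ge> 0" "- (1/2) \<le> Re z \<longleftrightarrow> B \<le> A"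
      using A by (auto simp: z(2) field_simps)
    moreover have "z \<in> F_minus \<longleftrightarrow> - (1/2) \<le> Re z \<and> Re z \<le> 0 \<and> norm z \<ge> 1"
      using z(1) by (simp add: F_minus_def upper_half_plane_def)
    ultimately show ?thesis
      using chi_minus_eq[OF z(1)] by (auto simp: cone_weight_def)
  qed
  then show ?thesis by (simp add: A_def B_def C_def)
qed

subsection \<open>Telescoping over the modular group\<close>

definition quads :: "(int \<times> int \<times> int \<times> int) set" where
  "quads = {(a, b, c, d). a * d - b * c = 1 \<and> c > 0}"

text \<open>\<open>Z\<close> bounds \<open>c\<close> and \<open>d\<close>, then \<open>y > 0\<close>
  yields a bound for \<open>a\<close>, and the determinant fixes \<open>b\<close>.\<close>

lemma finite_quads_bounded:
  fixes y Z T :: real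
  assumes "y > 0"
  shows "finite {(a, b, c, d) \<in> quads. (of_int c)\<^sup>2 + (of_int d)\<^sup>2 \<le> Z \<and> \<bar>of_int d - y * of_int a\<bar> \<le> T * of_int c}"
    (is "finite ?S")
proof -
  define n :: int where "n = \<lceil>max Z ((\<bar>T\<bar> * Z + Z) / y)\<rceil>"
  have "(a, b, c, d) \<in> (\<lambda>(a, c, d). (a, (a * d - 1) div c, c, d)) ` ({-n..n} \<times> {-n..n} \<times> {-n..n})"
    if "(a, b, c, d) \<in> ?S" for a b c d
  proof -
    have q: "a * d - b * c = 1" "c > 0" "(of_int c)\<^sup>2 + (of_int d)\<^sup>2 \<le> Z" "\<bar>of_int d - y * of_int a\<bar> \<le> T * of_int c"
      using that by (auto simp: quads_def)
    have sq: "\<bar>real_of_int k\<bar> \<le> (of_int k)\<^sup>2" for k :: int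
    proof (cases "k = 0")
      case False
      then have "1 \<le> \<bar>real_of_int k\<bar>" by linarith
      then have "\<bar>real_of_int k\<bar> * 1 \<le> \<bar>real_of_int k\<bar> * \<bar>real_of_int k\<bar>" by (intro mult_left_mono) auto
      then show ?thesis by (simp add: power2_eq_square)
    qed simp
    have cZ: "\<bar>of_int c\<bar> \<le> Z" and dZ: "\<bar>of_int d\<bar> \<le> Z"
      using sq[of c] sq[of d] q(3) zero_le_power2[of "real_of_int c"] zero_le_power2[of "real_of_int d"] by linarith+
    have "y * \<bar>real_of_int a\<bar> = \<bar>y * of_int a\<bar>" using assms by (simp add: abs_mult)
    also have "\<dots> \<le> T * of_int c + Z" using q(4) dZ by linarith
    also have "T * of_int c \<le> \<bar>T\<bar> * Z" using cZ q(2) by (intro mult_mono) auto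
    finally have "\<bar>real_of_int a\<bar> \<le> (\<bar>T\<bar> * Z + Z) / y" using assms by (simp add: field_simps)
    then have "a \<in> {-n..n}" "c \<in> {-n..n}" "d \<in> {-n..n}"
      using cZ dZ unfolding n_def by (simp_all add: le_ceiling_iff abs_le_iff) linarith+
    moreover have "b = (a * d - 1) div c" using q(1,2) by (metis add_diff_cancel_left' diff_add_cancel diff_diff_eq2 less_irrefl nonzero_mult_div_cancel_right)
    ultimately show ?thesis by (intro image_eqI[of _ _ "(a, c, d)"]) auto
  qed
  then have "?S \<subseteq> (\<lambda>(a, c, d). (a, (a * d - 1) div c, c, d)) ` ({-n..n} \<times> {-n..n} \<times> {-n..n})"
    by (intro subsetI) (auto split: prod.splits)
  then show ?thesis by (rule finite_subset) auto
qed

lemma summable_on_quads_bounded: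
  fixes f :: "int \<times> int \<times> int \<times> int \<Rightarrow> real" and y Z T :: real
  assumes "y > 0"
    and "\<And>a b c d. (a, b, c, d) \<in> quads \<Longrightarrow> f (a, b, c, d) \<noteq> 0 \<Longrightarrow>
      (of_int c)\<^sup>2 + (of_int d)\<^sup>2 \<le> Z \<and> \<bar>of_int d - y * of_int a\<bar> \<le> T * of_int c"
  shows "f summable_on quads"
proof (rule summable_on_cong_neutral[THEN iffD1])
  show "f summable_on {(a, b, c, d) \<in> quads. (of_int c)\<^sup>2 + (of_int d)\<^sup>2 \<le> Z \<and> \<bar>of_int d - y * of_int a\<bar> \<le> T * of_int c}"
    by (intro summable_on_finite finite_quads_bounded assms)
qed (use assms(2) in fastforce)+

text \<open>Right multiplication by \<open>T\<close> leaves \<open>c\<close> unchanged, so it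
  permutes \<open>quads\<close>.\<close>

lemma has_sum_quads_mult_T:
  "((\<lambda>(a, b, c, d). f (a, a + b, c, c + d)) has_sum s) quads \<longleftrightarrow> (f has_sum s) quads"
  by (rule has_sum_reindex_bij_witness[where i = "\<lambda>(a, b, c, d). (a, b - a, c, d - c)"
        and j = "\<lambda>(a, b, c, d). (a, a + b, c, c + d)"])
    (auto simp: quads_def algebra_simps)

text \<open>Right multiplication by \<open>S\<close> has bottom row \<open>(d, - c)\<close>, so it
  stays in \<open>quads\<close> only for \<open>d > 0\<close> and then lands in
  \<open>d < 0\<close>. The vanishing assumptions confine \<open>f\<close> and \<open>g\<close> to
  these two halves.\<close>

lemma has_sum_quads_mult_S:
  assumes "\<And>a b c d. (a, b, c, d) \<in> quads \<Longrightarrow> d \<le> 0 \<Longrightarrow> f (a, b, c, d) = 0"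
    and "\<And>a b c d. (a, b, c, d) \<in> quads \<Longrightarrow> d \<ge> 0 \<Longrightarrow> g (a, b, c, d) = 0"
    and "\<And>a b c d. (a, b, c, d) \<in> quads \<Longrightarrow> d > 0 \<Longrightarrow> g (b, - a, d, - c) = f (a, b, c, d)"
  shows "(f has_sum s) quads \<longleftrightarrow> (g has_sum s) quads"
proof -
  have "(f has_sum s) quads \<longleftrightarrow> (f has_sum s) {(a, b, c, d) \<in> quads. d > 0}"
    using assms(1) by (intro has_sum_cong_neutral) (auto, (meson not_less)+)
  also have "\<dots> \<longleftrightarrow> (g has_sum s) {(a, b, c, d) \<in> quads. d < 0}"
    by (rule has_sum_reindex_bij_witness[where i = "\<lambda>(a, b, c, d). (- b, a, - d, c)"
          and j = "\<lambda>(a, b, c, d). (b, - a, d, - c)"])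
      (use assms(3) in \<open>auto simp: quads_def algebra_simps\<close>)
  also have "\<dots> \<longleftrightarrow> (g has_sum s) quads"
    using assms(2) by (intro has_sum_cong_neutral) (auto, (meson not_less)+)
  finally show ?thesis .
qed

text \<open>
  As functions of \<open>x\<close>, \<open>B\<close> vanishes at \<open>edge_R\<close> and equals \<open>c\<close> at \<open>edge_R - 1\<close>, while \<open>C = c\<close> at \<open>edge_K\<close>
  (for \<open>d = 0\<close>, where \<open>edge_K\<close> is a junk value, \<open>C - c = y - 1 > 0\<close>). The interval \<open>[l, r]\<close> has \<open>edge_R - 1\<close> or
  \<open>edge_K\<close> as its left and \<open>edge_R\<close> or \<open>edge_K\<close> as its right end point, depending on \<open>y\<close>;
  \<open>edge_sum y g\<close> is \<open>g l - g r\<close>, or \<open>0\<close> if the interval is empty or a point.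
\<close>

definition edge_R :: "real \<Rightarrow> int \<times> int \<times> int \<times> int \<Rightarrow> real" where
  "edge_R y = (\<lambda>(a, b, c, d). (of_int d - y * of_int a) / of_int c)"

definition edge_K :: "real \<Rightarrow> int \<times> int \<times> int \<times> int \<Rightarrow> real" where
  "edge_K y = (\<lambda>(a, b, c, d). - (y * of_int b + of_int c) / of_int d)"

definition edge_sum :: "real \<Rightarrow> (real \<Rightarrow> real) \<Rightarrow> int \<times> int \<times> int \<times> int \<Rightarrow> real" where
  "edge_sum y g = (\<lambda>(a, b, c, d).
     of_bool (y > of_int (c\<^sup>2 + d\<^sup>2 - c * d)) * g (edge_R y (a, b, c, d) - 1)
   + of_bool (d < 0 \<and> of_int (c\<^sup>2 + d\<^sup>2) < y \<and> y \<le> of_int (c\<^sup>2 + d\<^sup>2 - c * d)) * g (edge_K y (a, b, c, d))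
   - of_bool (y > of_int (c\<^sup>2 + d\<^sup>2)) * g (edge_R y (a, b, c, d))
   - of_bool (d > 0 \<and> of_int (c\<^sup>2 + d\<^sup>2 - c * d) < y \<and> y \<le> of_int (c\<^sup>2 + d\<^sup>2)) * g (edge_K y (a, b, c, d)))"

lemma edge_sum_diff: "edge_sum y (\<lambda>t. g t - h t) q = edge_sum y g q - edge_sum y h q"
  by (cases q) (simp add: edge_sum_def algebra_simps)

lemma has_sum_diff:
  fixes f g :: "'a \<Rightarrow> real"
  assumes "(f has_sum s) A" "(g has_sum t) A"
  shows "((\<lambda>x. f x - g x) has_sum (s - t)) A"
  using has_sum_add[OF assms(1), of "\<lambda>x. - g x" "- t"] assms(2) by (simp add: has_sum_uminus)

text \<open>Bounded support of \<open>g\<close> makes the four parts of \<open>edge_sum\<close>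
  separately summable, so each may be reindexed on its own. \<open>T\<close> and \<open>S\<close>
  move every part to values of \<open>g\<close> at \<open>edge_R\<close>, where the coefficients
  cancel.\<close>

lemma has_sum_edge_sum:
  assumes y: "y > 0" and g: "\<And>t. \<bar>t\<bar> > T \<Longrightarrow> g t = 0"
  shows "(edge_sum y g has_sum 0) quads"
proof -
  define P where "P = (\<lambda>(a::int, b::int, c::int, d::int). y > of_int (c\<^sup>2 + d\<^sup>2 + c * d))"
  define Q where "Q = (\<lambda>(a::int, b::int, c::int, d::int). y > of_int (c\<^sup>2 + d\<^sup>2))"
  define pos where "pos = (\<lambda>(a::int, b::int, c::int, d::int). d > 0)"
  define neg where "neg = (\<lambda>(a::int, b::int, c::int, d::int). d < 0)"
  have summable: "(\<lambda>q. of_bool (C q) * g (edge_R y q)) summable_on quads"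
    if C: "\<And>q. C q \<Longrightarrow> P q \<or> Q q" for C
  proof (rule summable_on_quads_bounded[OF y])
    fix a b c d :: int assume q: "(a, b, c, d) \<in> quads" "of_bool (C (a, b, c, d)) * g (edge_R y (a, b, c, d)) \<noteq> 0"
    then have "c > 0" "C (a, b, c, d)" "g (edge_R y (a, b, c, d)) \<noteq> 0" by (auto simp: quads_def split: if_splits)
    then have T: "\<bar>(of_int d - y * of_int a) / of_int c\<bar> \<le> T" 
      using g by (force simp: edge_R_def not_less)
    then have "\<bar>of_int d - y * of_int a\<bar> \<le> T * of_int c"
      using \<open>c > 0\<close> by (simp add: abs_divide pos_divide_le_eq)
    moreover have "real_of_int (c\<^sup>2 + d\<^sup>2 + c * d) < y \<or> real_of_int (c\<^sup>2 + d\<^sup>2) < y"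
      using C[OF \<open>C (a, b, c, d)\<close>] by (simp add: P_def Q_def)
    then have "(of_int c)\<^sup>2 + (of_int d)\<^sup>2 \<le> 2 * y"
    proof
      \<comment> \<open>This bounds \<open>- c d\<close> by \<open>(c^2 + d^2) / 2\<close>, which is
        the origin of the factor \<open>2\<close> in \<open>2 * y\<close>.\<close>
      have "(real_of_int c + of_int d)\<^sup>2 \<ge> 0" by simp
      moreover assume "real_of_int (c\<^sup>2 + d\<^sup>2 + c * d) < y"
      ultimately show ?thesis by (simp add: power2_sum)
    next
      assume "real_of_int (c\<^sup>2 + d\<^sup>2) < y"
      then show ?thesis using y by simp
    qed
    ultimately show "(of_int c)\<^sup>2 + (of_int d)\<^sup>2 \<le> 2 * y \<and> \<bar>of_int d - y * of_int a\<bar> \<le> T * of_int c" by simp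
  qed
  obtain s1 where s1: "((\<lambda>q. of_bool (P q) * g (edge_R y q)) has_sum s1) quads"
    using summable[of P] by (auto simp: summable_on_def)
  obtain s2 where s2: "((\<lambda>q. of_bool (Q q) * g (edge_R y q)) has_sum s2) quads"
    using summable[of Q] by (auto simp: summable_on_def)
  obtain s3 where s3: "((\<lambda>q. of_bool (pos q \<and> Q q \<and> \<not> P q) * g (edge_R y q)) has_sum s3) quads"
    using summable[of "\<lambda>q. pos q \<and> Q q \<and> \<not> P q"] unfolding summable_on_def by blast
  obtain s4 where s4: "((\<lambda>q. of_bool (neg q \<and> P q \<and> \<not> Q q) * g (edge_R y q)) has_sum s4) quads"
    using summable[of "\<lambda>q. neg q \<and> P q \<and> \<not> Q q"] unfolding summable_on_def by blast
  have "((\<lambda>q. of_bool (P q) * g (edge_R y q) + of_bool (pos q \<and> Q q \<and> \<not> P q) * g (edge_R y q)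
      - of_bool (Q q) * g (edge_R y q) - of_bool (neg q \<and> P q \<and> \<not> Q q) * g (edge_R y q)) has_sum (s1 + s3 - s2 - s4)) quads"
    by (intro has_sum_add has_sum_diff s1 s2 s3 s4)
  \<comment> \<open>The thresholds in \<open>P\<close> and \<open>Q\<close> differ by
    \<open>c d\<close> with \<open>c > 0\<close>. Hence \<open>Q\<close> without \<open>P\<close>
    forces \<open>d > 0\<close>, \<open>P\<close> without \<open>Q\<close> forces
    \<open>d < 0\<close>, and the coefficient vanishes in all cases.\<close>
  moreover have "of_bool (P q) * g (edge_R y q) + of_bool (pos q \<and> Q q \<and> \<not> P q) * g (edge_R y q)
      - of_bool (Q q) * g (edge_R y q) - of_bool (neg q \<and> P q \<and> \<not> Q q) * g (edge_R y q) = 0" if "q \<in> quads" for q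
  proof -
    obtain a b c d where q: "q = (a, b, c, d)" by (cases q)
    have c: "c > 0" using that q by (simp add: quads_def)
    have "Q q \<and> \<not> P q \<Longrightarrow> real_of_int (c * d) > 0" "P q \<and> \<not> Q q \<Longrightarrow> real_of_int (c * d) < 0"
      by (auto simp: P_def Q_def q)
    then have "Q q \<and> \<not> P q \<Longrightarrow> pos q" "P q \<and> \<not> Q q \<Longrightarrow> neg q"
      using c by (auto simp: pos_def neg_def q zero_less_mult_iff mult_less_0_iff simp del: of_int_mult)
    then show ?thesis by (cases "P q"; cases "Q q") auto
  qed
  ultimately have "((\<lambda>_. 0) has_sum (s1 + s3 - s2 - s4)) quads"
    by (rule has_sum_cong[THEN iffD1, rotated])
  then have zero: "s1 + s3 - s2 - s4 = 0"
    by (rule has_sum_unique) simp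
  \<comment> \<open>Replacing \<open>d\<close> by \<open>c + d\<close> turns
    \<open>c^2 + d^2 - c d\<close> into the threshold of \<open>P\<close> and raises
    \<open>edge_R\<close> by \<open>1\<close>, which absorbs the shift of the left end
    point.\<close>
  have h1: "((\<lambda>(a, b, c, d). of_bool (y > of_int (c\<^sup>2 + d\<^sup>2 - c * d)) * g (edge_R y (a, b, c, d) - 1)) has_sum s1) quads"
  proof (subst has_sum_quads_mult_T[symmetric], rule has_sum_cong[THEN iffD1, OF _ s1])
    fix q assume "q \<in> quads"
    moreover obtain a b c d where q: "q = (a, b, c, d)" by (cases q)
    ultimately have c: "c > 0" by (simp add: quads_def)
    have "(c\<^sup>2 + (c + d)\<^sup>2 - c * (c + d)) = c\<^sup>2 + d\<^sup>2 + c * d" by (simp add: power2_eq_square algebra_simps)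
    moreover have "edge_R y (a, a + b, c, c + d) - 1 = edge_R y (a, b, c, d)"
      using c by (simp add: edge_R_def field_simps)
    ultimately show "of_bool (P q) * g (edge_R y q) = (case q of (a, b, c, d) \<Rightarrow>
        (case (a, a + b, c, c + d) of (a, b, c, d) \<Rightarrow> of_bool (y > of_int (c\<^sup>2 + d\<^sup>2 - c * d)) * g (edge_R y (a, b, c, d) - 1)))"
      by (simp only: q P_def prod.case)
  qed
  \<comment> \<open>\<open>edge_K\<close> at the product with \<open>S\<close> is
    \<open>edge_R\<close> at the original matrix.\<close>
  have h3: "((\<lambda>(a, b, c, d). of_bool (d < 0 \<and> of_int (c\<^sup>2 + d\<^sup>2) < y \<and> y \<le> of_int (c\<^sup>2 + d\<^sup>2 - c * d)) * g (edge_K y (a, b, c, d))) has_sum s3) quads"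
  proof (rule has_sum_quads_mult_S[THEN iffD1, OF _ _ _ s3])
    fix a b c d :: int assume "(a, b, c, d) \<in> quads" "d > 0"
    then have "edge_K y (b, - a, d, - c) = edge_R y (a, b, c, d)"
      by (simp add: edge_K_def edge_R_def quads_def field_simps)
    then show "(case (b, - a, d, - c) of (a, b, c, d) \<Rightarrow> of_bool (d < 0 \<and> of_int (c\<^sup>2 + d\<^sup>2) < y \<and> y \<le> of_int (c\<^sup>2 + d\<^sup>2 - c * d)) * g (edge_K y (a, b, c, d)))
      = of_bool (pos (a, b, c, d) \<and> Q (a, b, c, d) \<and> \<not> P (a, b, c, d)) * g (edge_R y (a, b, c, d))"
      using \<open>d > 0\<close> \<open>(a, b, c, d) \<in> quads\<close> by (auto simp: pos_def Q_def P_def quads_def algebra_simps)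
  qed (auto simp: pos_def)
  have h4: "((\<lambda>(a, b, c, d). of_bool (d > 0 \<and> of_int (c\<^sup>2 + d\<^sup>2 - c * d) < y \<and> y \<le> of_int (c\<^sup>2 + d\<^sup>2)) * g (edge_K y (a, b, c, d))) has_sum s4) quads"
  \<comment> \<open>Here \<open>S\<close> is read in the opposite direction: the
    \<open>edge_K\<close> terms lie in \<open>d > 0\<close>, the \<open>edge_R\<close> terms in
    \<open>d < 0\<close>.\<close>
  proof (rule has_sum_quads_mult_S[THEN iffD2, OF _ _ _ s4])
    fix a b c d :: int assume "(a, b, c, d) \<in> quads" "d > 0"
    then have "edge_R y (b, - a, d, - c) = edge_K y (a, b, c, d)"
      by (simp add: edge_K_def edge_R_def quads_def field_simps)
    then show "of_bool (neg (b, - a, d, - c) \<and> P (b, - a, d, - c) \<and> \<not> Q (b, - a, d, - c)) * g (edge_R y (b, - a, d, - c))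
      = (case (a, b, c, d) of (a, b, c, d) \<Rightarrow> of_bool (d > 0 \<and> of_int (c\<^sup>2 + d\<^sup>2 - c * d) < y \<and> y \<le> of_int (c\<^sup>2 + d\<^sup>2)) * g (edge_K y (a, b, c, d)))"
      using \<open>d > 0\<close> \<open>(a, b, c, d) \<in> quads\<close> by (auto simp: neg_def Q_def P_def quads_def algebra_simps)
  qed (auto simp: neg_def)
  have "((\<lambda>q. (case q of (a, b, c, d) \<Rightarrow> of_bool (y > of_int (c\<^sup>2 + d\<^sup>2 - c * d)) * g (edge_R y (a, b, c, d) - 1))
     + (case q of (a, b, c, d) \<Rightarrow> of_bool (d < 0 \<and> of_int (c\<^sup>2 + d\<^sup>2) < y \<and> y \<le> of_int (c\<^sup>2 + d\<^sup>2 - c * d)) * g (edge_K y (a, b, c, d)))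
     - of_bool (Q q) * g (edge_R y q)
     - (case q of (a, b, c, d) \<Rightarrow> of_bool (d > 0 \<and> of_int (c\<^sup>2 + d\<^sup>2 - c * d) < y \<and> y \<le> of_int (c\<^sup>2 + d\<^sup>2)) * g (edge_K y (a, b, c, d))))
     has_sum (s1 + s3 - s2 - s4)) quads"
    by (intro has_sum_add has_sum_diff h1 h3 h4 s2)
  also have "(\<lambda>q. (case q of (a, b, c, d) \<Rightarrow> of_bool (y > of_int (c\<^sup>2 + d\<^sup>2 - c * d)) * g (edge_R y (a, b, c, d) - 1))
     + (case q of (a, b, c, d) \<Rightarrow> of_bool (d < 0 \<and> of_int (c\<^sup>2 + d\<^sup>2) < y \<and> y \<le> of_int (c\<^sup>2 + d\<^sup>2 - c * d)) * g (edge_K y (a, b, c, d)))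
     - of_bool (Q q) * g (edge_R y q)
     - (case q of (a, b, c, d) \<Rightarrow> of_bool (d > 0 \<and> of_int (c\<^sup>2 + d\<^sup>2 - c * d) < y \<and> y \<le> of_int (c\<^sup>2 + d\<^sup>2)) * g (edge_K y (a, b, c, d))))
     = edge_sum y g"
    by (rule ext) (auto simp: edge_sum_def Q_def split: prod.splits)
  finally show ?thesis using zero by simp
qed

section \<open>The weight of a matrix as a difference of end point values\<close>

definition form_B :: "real \<Rightarrow> real \<Rightarrow> int \<times> int \<times> int \<times> int \<Rightarrow> real" where
  "form_B x y = (\<lambda>(a, b, c, d). of_int d - y * of_int a - x * of_int c)"

text \<open>This is \<open>C - c\<close>, whose sign compares the norm of the fixed point with
  \<open>1\<close>.\<close>

definition form_E :: "real \<Rightarrow> real \<Rightarrow> int \<times> int \<times> int \<times> int \<Rightarrow> real" where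
  "form_E x y = (\<lambda>(a, b, c, d). - (y * of_int b + x * of_int d) - of_int c)"

definition quad_weight :: "real \<Rightarrow> real \<Rightarrow> int \<times> int \<times> int \<times> int \<Rightarrow> real" where
  "quad_weight x y = (\<lambda>(a, b, c, d). cone_weight (of_int c) (form_B x y (a, b, c, d)) (form_E x y (a, b, c, d)))"

text \<open>The terms in \<open>x\<close> cancel, and \<open>a d - b c = 1\<close> leaves
  \<open>y\<close>. Thus \<open>y - (c^2 + d^2) = E c - B d\<close> and
  \<open>y - (c^2 + d^2 - c d) = E c + (c - B) d\<close>, which links the thresholds in
  \<open>edge_sum\<close> to the signs of \<open>B\<close> and \<open>E\<close>.\<close>

lemma form_identity:
  assumes "(a, b, c, d) \<in> quads"
  shows "y = (of_int c)\<^sup>2 + (of_int d)\<^sup>2 - form_B x y (a, b, c, d) * of_int d + form_E x y (a, b, c, d) * of_int c"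
proof -
  have "real_of_int (a * d - b * c) = 1" using assms by (simp add: quads_def)
  then have "y * (of_int a * of_int d - of_int b * of_int c) = y" by simp
  then show ?thesis by (simp add: form_B_def form_E_def algebra_simps power2_eq_square)
qed

lemma quad_weight_nonzero_iff:
  "quad_weight x y (a, b, c, d) \<noteq> 0 \<longleftrightarrow>
    0 \<le> form_B x y (a, b, c, d) \<and> form_B x y (a, b, c, d) \<le> of_int c \<and> 0 \<le> form_E x y (a, b, c, d)"
  by (auto simp: quad_weight_def cone_weight_def)

text \<open>In the form identity, a nonzero weight gives \<open>E c \<ge> 0\<close> and
  \<open>B d \<le> c * max d 0\<close>.\<close>

lemma quad_weight_nonzero_bound:
  assumes q: "(a, b, c, d) \<in> quads" and nz: "quad_weight x y (a, b, c, d) \<noteq> 0"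
  shows "c\<^sup>2 + d\<^sup>2 - c * max d 0 \<le> y"
proof -
  let ?B = "form_B x y (a, b, c, d)" and ?E = "form_E x y (a, b, c, d)"
  have c: "c > 0" using q by (simp add: quads_def)
  have *: "0 \<le> ?B" "?B \<le> of_int c" "0 \<le> ?E" using nz quad_weight_nonzero_iff[of x y a b c d] by auto
  have "?E * of_int c \<ge> 0" using * c by simp
  moreover have "?B * of_int d \<le> of_int c * of_int (max d 0)"
  proof -
    have "?B * of_int d \<le> ?B * of_int (max d 0)" using * by (intro mult_left_mono) auto
    also have "\<dots> \<le> of_int c * of_int (max d 0)" using * by (intro mult_right_mono) auto
    finally show ?thesis .
  qed
  ultimately show ?thesis using form_identity[OF q, of y x] by simp
qed

text \<open>
  The half-weights of the end points minus \<open>\<alpha>\<close> at the two corners: for \<open>i\<close> the interval is a point iff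
  \<open>d < 0\<close>, for \<open>\<rho>\<^sup>2\<close> it is a point iff \<open>d > 0\<close>.
\<close>

definition corner_i :: "real \<Rightarrow> real \<Rightarrow> int \<times> int \<times> int \<times> int \<Rightarrow> real" where
  "corner_i x y = (\<lambda>(a, b, c, d).
     of_bool (form_B x y (a, b, c, d) = 0 \<and> form_E x y (a, b, c, d) = 0) * sgn (of_int d) / 4)"

definition corner_rho :: "real \<Rightarrow> real \<Rightarrow> int \<times> int \<times> int \<times> int \<Rightarrow> real" where
  "corner_rho x y = (\<lambda>(a, b, c, d).
     of_bool (form_B x y (a, b, c, d) = of_int c \<and> form_E x y (a, b, c, d) = 0) * ((1 - sgn (of_int d)) / 4 - 1/6))"

text \<open>This is the comparison of end point signs with weights, stated for real unknowns. It is
  verified by cases on the signs of \<open>E\<close>, \<open>B\<close>, \<open>c - B\<close> and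
  \<open>d\<close>.\<close>

lemma edge_weight_identity:
  fixes B E c d :: real
  assumes "c > 0" and "d = 0 \<Longrightarrow> E > 0"
  shows "of_bool (E * c + (c - B) * d > 0) * sgn (c - B)
     + of_bool (d < 0 \<and> E * c - B * d > 0 \<and> E * c + (c - B) * d \<le> 0) * (- sgn d * sgn E)
     - of_bool (E * c - B * d > 0) * (- sgn B)
     - of_bool (d > 0 \<and> E * c + (c - B) * d > 0 \<and> E * c - B * d \<le> 0) * (- sgn d * sgn E)
    = 2 * (cone_weight c B E + of_bool (B = 0 \<and> E = 0) * sgn d / 4
       + of_bool (B = c \<and> E = 0) * ((1 - sgn d) / 4 - 1/6))"
proof -
  \<comment> \<open>Naming the products leaves linear conditions: the signs of \<open>p\<close>,
    \<open>q\<close>, \<open>r\<close> are known in each case, and \<open>q + r = c d\<close> has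
    the sign of \<open>d\<close>.\<close>
  define p q r where "p = E * c" and "q = B * d" and "r = (c - B) * d"
  have p: "p > 0 \<longleftrightarrow> E > 0" "p < 0 \<longleftrightarrow> E < 0" "p = 0 \<longleftrightarrow> E = 0"
    using assms(1) by (auto simp: p_def zero_less_mult_iff mult_less_0_iff)
  have qr: "q + r = c * d" unfolding q_def r_def by (simp add: algebra_simps)
  consider "d = 0" | "d > 0" | "d < 0" by linarith
  then show ?thesis
  proof cases
    case 1
    then show ?thesis using assms by (auto simp: cone_weight_def sgn_if)
  next
    case 2
    have q: "q > 0 \<longleftrightarrow> B > 0" "q < 0 \<longleftrightarrow> B < 0" "q = 0 \<longleftrightarrow> B = 0"
      using 2 by (auto simp: q_def zero_less_mult_iff mult_less_0_iff)
    have r: "r > 0 \<longleftrightarrow> c > B" "r < 0 \<longleftrightarrow> c < B" "r = 0 \<longleftrightarrow> c = B"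
      using 2 by (auto simp: r_def zero_less_mult_iff mult_less_0_iff)
    have sd: "sgn d = 1" using 2 by simp
    have qr0: "q + r > 0" using 2 assms qr by simp
    show ?thesis
      unfolding p_def[symmetric] q_def[symmetric] r_def[symmetric]
      by (rule linorder_cases[of E 0]; rule linorder_cases[of B 0]; rule linorder_cases[of B c])
        (use p q r sd qr0 2 assms(1) in \<open>auto simp: cone_weight_def of_bool_def\<close>)
  next
    case 3
    have q: "q > 0 \<longleftrightarrow> B < 0" "q < 0 \<longleftrightarrow> B > 0" "q = 0 \<longleftrightarrow> B = 0"
      using 3 by (auto simp: q_def zero_less_mult_iff mult_less_0_iff)
    have r: "r > 0 \<longleftrightarrow> c < B" "r < 0 \<longleftrightarrow> c > B" "r = 0 \<longleftrightarrow> c = B"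
      using 3 by (auto simp: r_def zero_less_mult_iff mult_less_0_iff)
    have sd: "sgn d = -1" using 3 by simp
    have qr0: "q + r < 0" using 3 assms qr by (simp add: mult_less_0_iff)
    show ?thesis
      unfolding p_def[symmetric] q_def[symmetric] r_def[symmetric]
      by (rule linorder_cases[of E 0]; rule linorder_cases[of B 0]; rule linorder_cases[of B c])
        (use p q r sd qr0 3 assms(1) in \<open>auto simp: cone_weight_def of_bool_def\<close>)
  qed
qed

text \<open>For \<open>g t = sgn (x - t) / 2\<close> and \<open>l < r\<close>, the difference
  \<open>g l - g r\<close> is \<open>1\<close> inside \<open>[l, r]\<close>, \<open>1/2\<close> at
  its end points and \<open>0\<close> outside. The corner terms account for the deviation at
  \<open>i\<close> and \<open>rho^2\<close>.\<close>

lemma edge_sum_sgn: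
  assumes q: "q \<in> quads" and y: "y > 1"
  shows "edge_sum y (\<lambda>t. sgn (x - t) / 2) q = quad_weight x y q + corner_i x y q + corner_rho x y q"
proof -
  obtain a b c d where q_eq [simp]: "q = (a, b, c, d)" by (cases q)
  define B E where "B = form_B x y q" and "E = form_E x y q"
  have det: "a * d - b * c = 1" and c: "c > 0" using q by (auto simp: quads_def)
  have yid: "y = (of_int c)\<^sup>2 + (of_int d)\<^sup>2 - B * of_int d + E * of_int c"
    using form_identity[of a b c d y x] q by (simp add: B_def E_def)
  \<comment> \<open>For \<open>d = 0\<close> the determinant forces \<open>c = 1\<close>, and the
    form identity becomes \<open>E = y - 1\<close>. This is where \<open>y > 1\<close>
    enters.\<close>
  have E0: "E > 0" if "d = 0"
  proof -
    have "c * (- b) = 1" using det that by (simp add: mult.commute)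
    then have "c = 1" using c by (simp only: pos_zmult_eq_1_iff)
    then show ?thesis using yid that y by simp
  qed
  have R: "sgn (x - edge_R y q) = - sgn B" "sgn (x - (edge_R y q - 1)) = sgn (of_int c - B)"
  proof -
    have B: "B = of_int c * (edge_R y q - x)" and "of_int c - B = of_int c * (x - (edge_R y q - 1))"
      using c by (auto simp: B_def form_B_def edge_R_def field_simps)
    then show "sgn (x - (edge_R y q - 1)) = sgn (of_int c - B)" using c by (simp add: sgn_mult)
    show "sgn (x - edge_R y q) = - sgn B" unfolding B sgn_mult using c
      by simp (metis minus_diff_eq sgn_minus)
  qed
  have K: "sgn (x - edge_K y q) = - sgn (of_int d) * sgn E" if "d \<noteq> 0"
  proof -
    have E: "E = of_int d * (edge_K y q - x)"
      using that by (auto simp: E_def form_E_def edge_K_def field_simps)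
    have "- sgn (of_int d) * sgn E = - sgn (edge_K y q - x)"
      unfolding E sgn_mult using that by (cases "d > 0") auto
    also have "\<dots> = sgn (x - edge_K y q)" by (metis minus_diff_eq sgn_minus)
    finally show ?thesis ..
  qed
  have conds: "y > of_int (c\<^sup>2 + d\<^sup>2 - c * d) \<longleftrightarrow> E * of_int c + (of_int c - B) * of_int d > 0"
      "y > of_int (c\<^sup>2 + d\<^sup>2) \<longleftrightarrow> E * of_int c - B * of_int d > 0"
    using yid by (auto simp: algebra_simps)
  have conds': "y \<le> of_int (c\<^sup>2 + d\<^sup>2 - c * d) \<longleftrightarrow> E * of_int c + (of_int c - B) * of_int d \<le> 0"
      "y \<le> of_int (c\<^sup>2 + d\<^sup>2) \<longleftrightarrow> E * of_int c - B * of_int d \<le> 0"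
    using conds by linarith+
  have "2 * edge_sum y (\<lambda>t. sgn (x - t) / 2) q =
       of_bool (E * of_int c + (of_int c - B) * of_int d > 0) * sgn (of_int c - B)
     + of_bool (d < 0 \<and> E * of_int c - B * of_int d > 0 \<and> E * of_int c + (of_int c - B) * of_int d \<le> 0) * sgn (x - edge_K y q)
     - of_bool (E * of_int c - B * of_int d > 0) * (- sgn B)
     - of_bool (d > 0 \<and> E * of_int c + (of_int c - B) * of_int d > 0 \<and> E * of_int c - B * of_int d \<le> 0) * sgn (x - edge_K y q)"
    unfolding conds[symmetric] conds'[symmetric] R[symmetric] by (simp add: edge_sum_def algebra_simps)
  also have "\<dots> =
       of_bool (E * of_int c + (of_int c - B) * of_int d > 0) * sgn (of_int c - B)
     + of_bool (real_of_int d < 0 \<and> E * of_int c - B * of_int d > 0 \<and> E * of_int c + (of_int c - B) * of_int d \<le> 0) * (- sgn (of_int d) * sgn E)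
     - of_bool (E * of_int c - B * of_int d > 0) * (- sgn B)
     - of_bool (real_of_int d > 0 \<and> E * of_int c + (of_int c - B) * of_int d > 0 \<and> E * of_int c - B * of_int d \<le> 0) * (- sgn (of_int d) * sgn E)"
    using K by (cases "d = 0") auto
  also have "\<dots> = 2 * (cone_weight (of_int c) B E + of_bool (B = 0 \<and> E = 0) * sgn (of_int d) / 4
       + of_bool (B = of_int c \<and> E = 0) * ((1 - sgn (of_int d)) / 4 - 1/6))"
    by (rule edge_weight_identity) (use c E0 in auto)
  also have "\<dots> = 2 * (quad_weight x y q + corner_i x y q + corner_rho x y q)"
    by (simp only: quad_weight_def corner_i_def corner_rho_def B_def E_def q_eq prod.case)
  finally show ?thesis by simp
qed

section \<open>Cancellation of the corner terms\<close>

text \<open>At a corner the form identity makes \<open>y\<close> equal to \<open>c^2 + d^2\<close>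
  or \<open>c^2 + d^2 - c d\<close>, and either value bounds \<open>c^2 + d^2\<close> by
  \<open>2 y\<close>.\<close>

lemma summable_corner:
  fixes f :: "int \<times> int \<times> int \<times> int \<Rightarrow> real"
  assumes y: "y > 0"
    and f: "\<And>a b c d. (a, b, c, d) \<in> quads \<Longrightarrow> f (a, b, c, d) \<noteq> 0 \<Longrightarrow>
      (form_B x y (a, b, c, d) = 0 \<or> form_B x y (a, b, c, d) = of_int c) \<and> form_E x y (a, b, c, d) = 0"
  shows "f summable_on quads"
proof (rule summable_on_quads_bounded[OF y])
  fix a b c d assume q: "(a, b, c, d) \<in> quads" and "f (a, b, c, d) \<noteq> 0"
  then have *: "form_B x y (a, b, c, d) = 0 \<or> form_B x y (a, b, c, d) = of_int c" "form_E x y (a, b, c, d) = 0"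
    using f by auto
  have c: "c > 0" using q by (simp add: quads_def)
  have "of_int d - y * of_int a = form_B x y (a, b, c, d) + x * of_int c" by (simp add: form_B_def)
  also have "\<bar>\<dots>\<bar> \<le> of_int c + \<bar>x\<bar> * of_int c" using * c by (auto simp: abs_mult intro!: abs_triangle_ineq[THEN order_trans])
  finally have "\<bar>of_int d - y * of_int a\<bar> \<le> (1 + \<bar>x\<bar>) * of_int c" by (simp add: algebra_simps)
  moreover have "(of_int c)\<^sup>2 + (of_int d)\<^sup>2 \<le> 2 * y"
    using *(1)
  proof
    assume "form_B x y (a, b, c, d) = 0"
    then show ?thesis using form_identity[OF q, of y x] * y by simp
  next
    assume "form_B x y (a, b, c, d) = of_int c"
    then have "y = (of_int c)\<^sup>2 + (of_int d)\<^sup>2 - of_int c * of_int d" using form_identity[OF q, of y x] * by simp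
    moreover have "(real_of_int c - of_int d)\<^sup>2 \<ge> 0" by simp
    ultimately show ?thesis by (simp add: power2_diff)
  qed
  ultimately show "(of_int c)\<^sup>2 + (of_int d)\<^sup>2 \<le> 2 * y \<and> \<bar>of_int d - y * of_int a\<bar> \<le> (1 + \<bar>x\<bar>) * of_int c" by blast
qed

text \<open>\<open>j\<close> is right multiplication by \<open>S\<close> up to sign, an involution.
  As \<open>S\<close> fixes \<open>i\<close>, it preserves the corner condition while flipping the
  sign of \<open>d\<close>, so the sum is its own negative.\<close>

lemma has_sum_corner_i:
  assumes y: "y > 1"
  shows "(corner_i x y has_sum 0) quads"
proof -
  let ?Q = "{(a, b, c, d) \<in> quads. d \<noteq> 0}"
  define j where "j = (\<lambda>(a::int, b::int, c::int, d::int). if d > 0 then (b, - a, d, - c) else (- b, a, - d, c))"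
  have "corner_i x y summable_on quads"
    by (rule summable_corner) (use y in \<open>auto simp: corner_i_def split: if_splits\<close>)
  then obtain s where s: "(corner_i x y has_sum s) quads" by (auto simp: summable_on_def)
  also have "?this \<longleftrightarrow> (corner_i x y has_sum s) ?Q"
    by (rule has_sum_cong_neutral) (auto simp: corner_i_def)
  finally have sQ: "(corner_i x y has_sum s) ?Q" .
  moreover have "((\<lambda>q. corner_i x y (j q)) has_sum s) ?Q \<longleftrightarrow> (corner_i x y has_sum s) ?Q"
    by (rule has_sum_reindex_bij_witness[where i = j and j = j])
      (auto simp: j_def quads_def algebra_simps split: if_splits)
  ultimately have "((\<lambda>q. corner_i x y q + corner_i x y (j q)) has_sum (s + s)) ?Q"
    by (intro has_sum_add) auto
  moreover have "corner_i x y q + corner_i x y (j q) = 0" if "q \<in> ?Q" for q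
    using that by (auto simp: corner_i_def j_def form_B_def form_E_def quads_def sgn_if split: if_splits)
  ultimately have "((\<lambda>_. 0) has_sum (s + s)) ?Q"
    by (rule has_sum_cong[THEN iffD1, rotated])
  then have "s + s = 0" by (rule has_sum_unique) simp
  then show ?thesis using s by simp
qed

text \<open>\<open>j\<close> is right multiplication by \<open>(0, -1; 1, 1)\<close> up to sign.
  This matrix fixes \<open>rho^2\<close> and has order 3 in \<open>PSL2Z\<close>, so three times the
  sum is a sum of orbit totals, each of which vanishes.\<close>

lemma has_sum_corner_rho:
  assumes y: "y > 1"
  shows "(corner_rho x y has_sum 0) quads"
proof -
  \<comment> \<open>\<open>j\<close> has lower left entry \<open>|d|\<close> and sends
    \<open>d = c\<close> to \<open>d = 0\<close>, so both values are removed to keep the orbits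
    inside \<open>quads\<close>.\<close>
  let ?Q = "{(a, b, c, d) \<in> quads. d \<noteq> 0 \<and> d \<noteq> c}"
  define j where "j = (\<lambda>(a::int, b::int, c::int, d::int). if d > 0 then (b, b - a, d, d - c) else (- b, a - b, - d, c - d))"
  have "corner_rho x y summable_on quads"
    by (rule summable_corner) (use y in \<open>auto simp: corner_rho_def split: if_splits\<close>)
  then obtain s where s: "(corner_rho x y has_sum s) quads" by (auto simp: summable_on_def)
  also have "?this \<longleftrightarrow> (corner_rho x y has_sum s) ?Q"
  proof (rule has_sum_cong_neutral)
    fix q assume "q \<in> quads - ?Q"
    then obtain a b c d where q: "q = (a, b, c, d)" "q \<in> quads" "d = 0 \<or> d = c" by auto
    \<comment> \<open>For the removed matrices \<open>c\<close> divides \<open>1\<close>, and at the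
      corner the form identity would give \<open>y = 1\<close>.\<close>
    then have "c * (if d = 0 then - b else a - b) = 1" "c > 0" by (auto simp: quads_def algebra_simps)
    then have "c = 1" by (simp only: pos_zmult_eq_1_iff)
    show "corner_rho x y q = 0"
    proof (rule ccontr)
      assume "corner_rho x y q \<noteq> 0"
      then have "form_B x y q = of_int c" "form_E x y q = 0" by (auto simp: corner_rho_def q split: if_splits)
      then show False using form_identity[of a b c d y x] q y \<open>c = 1\<close> by auto
    qed
  qed auto
  finally have s1: "(corner_rho x y has_sum s) ?Q" .
  have j: "((\<lambda>q. f (j q)) has_sum s) ?Q \<longleftrightarrow> (f has_sum s) ?Q" for f :: "_ \<Rightarrow> real"
    by (rule has_sum_reindex_bij_witness[where i = "j \<circ> j" and j = j])
      (auto simp: j_def quads_def algebra_simps split: if_splits)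
  have s2: "((\<lambda>q. corner_rho x y (j q)) has_sum s) ?Q"
    using s1 by (rule j[THEN iffD2])
  have s3: "((\<lambda>q. corner_rho x y (j (j q))) has_sum s) ?Q"
    using s2 by (rule j[THEN iffD2])
  have "((\<lambda>q. corner_rho x y q + corner_rho x y (j q) + corner_rho x y (j (j q))) has_sum (s + s + s)) ?Q"
    by (intro has_sum_add s1 s2 s3)
  moreover have "corner_rho x y q + corner_rho x y (j q) + corner_rho x y (j (j q)) = 0" if "q \<in> ?Q" for q
  proof -
    define k where "k = (\<lambda>(a, b, c, d). form_B x y (a, b, c, d) = of_int c \<and> form_E x y (a, b, c, d) = 0)"
    define w where "w = (\<lambda>(a::int, b::int, c::int, d::int). (1 - sgn (real_of_int d)) / 4 - 1/6)"
    have rho: "corner_rho x y q = of_bool (k q) * w q" for q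
      by (cases q) (simp only: corner_rho_def k_def w_def prod.case)
    have k: "k (j q) \<longleftrightarrow> k q" for q
      by (cases q) (auto simp: k_def j_def form_B_def form_E_def algebra_simps)
    \<comment> \<open>Exactly one of the three matrices has \<open>d < 0\<close>, so the weights are
      \<open>1/3\<close>, \<open>-1/6\<close>, \<open>-1/6\<close> in some order.\<close>
    have "w q + w (j q) + w (j (j q)) = 0"
      using that by (cases q) (auto simp: w_def j_def quads_def sgn_if)
    then show ?thesis by (simp add: rho k del: of_bool_eq_0_iff flip: distrib_left)
  qed
  ultimately have "((\<lambda>_. 0) has_sum (s + s + s)) ?Q"
    by (rule has_sum_cong[THEN iffD1, rotated])
  then have "s + s + s = 0" by (rule has_sum_unique) simp
  then show ?thesis using s by simp
qed

section \<open>The total for \<open>y > 1\<close>\<close>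

text \<open>\<open>E \<ge> 0\<close> makes \<open>b\<close> negative, so
  \<open>a d = 1 + b c \<le> 0\<close>. Each sign of \<open>a\<close> then contradicts the bounds on
  \<open>B\<close> and \<open>E\<close>, and \<open>a = 0\<close> forces \<open>b = -1\<close> and
  \<open>c = 1\<close>.\<close>

lemma quad_weight_at_zero:
  assumes q: "(a, b, c, d) \<in> quads" and y: "y > 1" and nz: "quad_weight 0 y (a, b, c, d) \<noteq> 0"
  shows "a = 0 \<and> b = -1 \<and> c = 1 \<and> (d = 0 \<or> d = 1)"
proof -
  have det: "a * d - b * c = 1" and c: "c > 0" using q by (auto simp: quads_def)
  have *: "y * of_int a \<le> of_int d" "of_int d - y * of_int a \<le> of_int c" "of_int c \<le> - y * of_int b"
    using nz quad_weight_nonzero_iff[of 0 y a b c d] by (auto simp: form_B_def form_E_def)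
  have "0 < y * - real_of_int b" using * c by simp
  then have b: "b < 0" using y by (simp add: mult_less_0_iff)
  then have "b * c \<le> -1" using c by (smt (verit) mult_less_0_iff)
  then have ad: "a * d \<le> 0" using det by simp
  have "a = 0"
  proof (rule ccontr)
    assume "a \<noteq> 0"
    then consider "a > 0" | "a < 0" by linarith
    then show False
    proof cases
      case 1
      then have "real_of_int d > 0" using *(1) y by (smt (verit) mult_pos_pos of_int_0_less_iff)
      then show False using ad 1 by (simp add: mult_le_0_iff)
    next
      case 2
      then have d: "d \<ge> 0" using ad by (simp add: mult_le_0_iff)
      define p where "p = real_of_int (- a)"
      have p: "p \<ge> 1" using 2 unfolding p_def by linarith
      \<comment> \<open>Here \<open>B = d + y p \<le> c\<close>, while \<open>E \<ge> 0\<close>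
        gives \<open>c^2 \<le> - y b c = y (1 + p d)\<close>. Together they yield
        \<open>(y p)^2 \<le> y\<close>, impossible for \<open>y > 1\<close> and
        \<open>p \<ge> 1\<close>.\<close>
      have "(of_int d + y * p)\<^sup>2 \<le> (real_of_int c)\<^sup>2"
        using * d p y by (intro power_mono) (auto simp: p_def)
      also have "\<dots> \<le> (- y * of_int b) * of_int c"
        using *(3) c unfolding power2_eq_square by (intro mult_right_mono) auto
      also have "\<dots> = y * of_int (1 - a * d)" using det by (simp add: algebra_simps flip: of_int_mult of_int_add of_int_diff)
      also have "\<dots> = y + y * p * of_int d" by (simp add: p_def algebra_simps)
      finally have "(of_int d)\<^sup>2 + y * p * of_int d + (y * p)\<^sup>2 \<le> y" by (simp add: power2_sum algebra_simps)
      moreover have "y * p * of_int d \<ge> 0" using y p d by simp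
      moreover have "y * y \<le> (y * p)\<^sup>2"
      proof -
        have "y * 1 \<le> y * p" using y p by (intro mult_left_mono) auto
        then show ?thesis unfolding power2_eq_square using y by (intro mult_mono) auto
      qed
      moreover have "y < y * y" using y by simp
      ultimately show False using zero_le_power2[of "real_of_int d"] by linarith
    qed
  qed
  then have "c * (- b) = 1" using det by (simp add: mult.commute)
  then have "c = 1" "b = -1" using c by (simp_all only: pos_zmult_eq_1_iff) auto
  then show ?thesis using * \<open>a = 0\<close> by auto
qed

text \<open>Up to corner terms of total \<open>0\<close>, the sum is that of
  \<open>edge_sum\<close>. Telescoping shows it independent of \<open>x\<close>, and it is evaluated
  at \<open>x = 0\<close>.\<close>

lemma has_sum_quad_weight_gt_1:
  assumes y: "y > 1"
  shows "(quad_weight x y has_sum 1) quads"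
proof -
  have edge: "(edge_sum y (\<lambda>t. sgn (x - t) / 2) has_sum s) quads \<longleftrightarrow> (quad_weight x y has_sum s) quads" for x s
  proof -
    have corners: "((\<lambda>q. corner_i x y q + corner_rho x y q) has_sum (0 + 0)) quads"
      by (intro has_sum_add has_sum_corner_i has_sum_corner_rho y)
    have eq: "(edge_sum y (\<lambda>t. sgn (x - t) / 2) has_sum s) quads \<longleftrightarrow>
        ((\<lambda>q. quad_weight x y q + (corner_i x y q + corner_rho x y q)) has_sum s) quads"
      by (rule has_sum_cong) (simp add: edge_sum_sgn y)
    show ?thesis
      unfolding eq
      using has_sum_add[OF _ corners, of "quad_weight x y" s]
        has_sum_diff[OF _ corners, of "\<lambda>q. quad_weight x y q + (corner_i x y q + corner_rho x y q)" s] by auto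
  qed
  have "(quad_weight 0 y has_sum 1) quads"
  proof (rule has_sum_cong_neutral[THEN iffD1])
    \<comment> \<open>Both matrices have \<open>E = y - 1 > 0\<close>, with \<open>B = 0\<close> and
      \<open>B = c\<close> respectively, so each has weight \<open>1/2\<close>.\<close>
    show "(quad_weight 0 y has_sum 1) {(0, -1, 1, 0), (0, -1, 1, 1)}"
      using y by (intro has_sum_finiteI) (auto simp: quad_weight_def form_B_def form_E_def cone_weight_def)
    show "quad_weight 0 y q = 0" if "q \<in> quads - {(0, -1, 1, 0), (0, -1, 1, 1)}" for q
      using that quad_weight_at_zero[OF _ y] by (cases q) blast
  qed (auto simp: quads_def)
  then have zero: "(edge_sum y (\<lambda>t. sgn (0 - t) / 2) has_sum 1) quads" by (simp only: edge)
  \<comment> \<open>The two sign functions agree for \<open>|t| > |x|\<close>, so their difference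
    has the bounded support required for telescoping.\<close>
  have "(edge_sum y (\<lambda>t. sgn (x - t) / 2 - sgn (0 - t) / 2) has_sum 0) quads"
    using y by (intro has_sum_edge_sum[where T = "\<bar>x\<bar>"]) (auto simp: sgn_if)
  then have "((\<lambda>q. edge_sum y (\<lambda>t. sgn (x - t) / 2) q - edge_sum y (\<lambda>t. sgn (0 - t) / 2) q) has_sum 0) quads"
    by (rule has_sum_cong[THEN iffD1, rotated]) (rule edge_sum_diff)
  from has_sum_add[OF this zero] show ?thesis by (simp flip: edge)
qed

subsection \<open>The cases \<open>y \<le> 1\<close> and the sum over the modular group\<close>

text \<open>For \<open>d > 0\<close> the expression is \<open>(c - d)^2 + c d\<close>. Being the
  lower bound for \<open>y\<close> at nonzero weight, it excludes \<open>y < 1\<close> and leaves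
  two bottom rows for \<open>y = 1\<close>.\<close>

lemma norm_form_ge_1:
  fixes c d :: int
  assumes "c > 0"
  shows "c\<^sup>2 + d\<^sup>2 - c * max d 0 \<ge> 1"
    and "c\<^sup>2 + d\<^sup>2 - c * max d 0 = 1 \<Longrightarrow> c = 1 \<and> (d = 0 \<or> d = 1)"
proof -
  have *: "c\<^sup>2 + d\<^sup>2 - c * d = (c - d)\<^sup>2 + c * d"
    by (simp add: power2_eq_square algebra_simps)
  show "c\<^sup>2 + d\<^sup>2 - c * max d 0 \<ge> 1 "
  proof (cases "d > 0")
    case True
    then have "c * d \<ge> 1" using assms by (smt (verit) mult_pos_pos)
    then have "c\<^sup>2 + d\<^sup>2 - c * d \<ge> 1" using zero_le_power2[of "c - d"] unfolding * by linarith
    then show ?thesis using True by (simp add: max_def)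
  next
    case False
    have "c\<^sup>2 \<ge> 1" using assms by (simp add: int_one_le_iff_zero_less)
    then have "c\<^sup>2 + d\<^sup>2 \<ge> 1" using zero_le_power2[of d] by linarith
    then show ?thesis using False by (simp add: max_def)
  qed
  show "c = 1 \<and> (d = 0 \<or> d = 1)" if eq: "c\<^sup>2 + d\<^sup>2 - c * max d 0 = 1"
  proof (cases "d > 0")
    case True
    then have "c * d \<ge> 1" using assms by (smt (verit) mult_pos_pos)
    moreover have "(c - d)\<^sup>2 + c * d = 1" using True eq by (simp add: max_def flip: *)
    ultimately have "c * d = 1" using zero_le_power2[of "c - d"] by linarith
    then show ?thesis using assms by (simp add: pos_zmult_eq_1_iff)
  next
    case False
    then have "c\<^sup>2 + d\<^sup>2 = 1" using eq by (simp add: max_def)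
    moreover have "c\<^sup>2 \<ge> 1" using assms by (simp add: int_one_le_iff_zero_less)
    ultimately have "d\<^sup>2 = 0" "c\<^sup>2 = 1" using zero_le_power2[of d] by linarith+
    then show ?thesis using assms by (simp add: power2_eq_1_iff)
  qed
qed

lemma has_sum_quad_weight_lt_1:
  assumes "y < 1"
  shows "(quad_weight x y has_sum 0) quads"
proof (rule has_sum_0)
  fix q assume q: "q \<in> quads"
  obtain a b c d where [simp]: "q = (a, b, c, d)" by (cases q)
  have "1 \<le> c\<^sup>2 + d\<^sup>2 - c * max d 0" using q by (intro norm_form_ge_1) (simp add: quads_def)
  then have "y < of_int (c\<^sup>2 + d\<^sup>2 - c * max d 0)" using assms by linarith
  then show "quad_weight x y q = 0" using quad_weight_nonzero_bound[of a b c d x y] q by fastforce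
qed

text \<open>The bottom row is \<open>(1, 0)\<close> or \<open>(1, 1)\<close>. In the first case
  \<open>E = 0\<close> and the bounds on \<open>B\<close> restrict \<open>a\<close>; in the second,
  \<open>B \<le> c\<close> and \<open>E \<ge> 0\<close> are opposite inequalities between
  \<open>x\<close> and \<open>- a\<close>.\<close>

lemma quad_weight_1_cases:
  assumes q: "(a, b, c, d) \<in> quads" and nz: "quad_weight x 1 (a, b, c, d) \<noteq> 0"
  shows "b = -1 \<and> c = 1 \<and> d = 0 \<and> x \<le> - of_int a \<and> - of_int a \<le> x + 1 \<or> b = a - 1 \<and> c = 1 \<and> d = 1 \<and> x = - of_int a"
proof -
  have c: "c > 0" and det: "a * d - b * c = 1" using q by (auto simp: quads_def)
  have "real_of_int (c\<^sup>2 + d\<^sup>2 - c * max d 0) \<le> 1" using quad_weight_nonzero_bound[OF q nz] by simp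
  then have "c\<^sup>2 + d\<^sup>2 - c * max d 0 = 1" using norm_form_ge_1(1)[OF c, of d] by linarith
  then have cd: "c = 1 \<and> (d = 0 \<or> d = 1)" by (rule norm_form_ge_1(2)[OF c])
  moreover have "0 \<le> form_B x 1 (a, b, c, d)" "form_B x 1 (a, b, c, d) \<le> of_int c" "0 \<le> form_E x 1 (a, b, c, d)"
    using nz quad_weight_nonzero_iff[of x 1 a b c d] by auto
  ultimately show ?thesis
    using det by (auto simp: form_B_def form_E_def)
qed

text \<open>All three fixed points are corners: \<open>i\<close> once, with weight
  \<open>1/4\<close>, and \<open>rho^2\<close> twice, with weight \<open>1/6\<close> each.\<close>

lemma has_sum_quad_weight_1_int:
  "(quad_weight (of_int n) 1 has_sum (7/12)) quads"
proof (rule has_sum_cong_neutral[THEN iffD1])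
  let ?S = "{(- n, -1, 1, 0), (- n - 1, -1, 1, 0), (- n, - n - 1, 1, 1)}"
  show "(quad_weight (of_int n) 1 has_sum (7/12)) ?S"
    by (intro has_sum_finiteI) (auto simp: quad_weight_def form_B_def form_E_def cone_weight_def)
  show "quad_weight (of_int n) 1 q = 0" if "q \<in> quads - ?S" for q
  proof (rule ccontr)
    assume nz: "quad_weight (of_int n) 1 q \<noteq> 0"
    obtain a b c d where q: "q = (a, b, c, d)" by (cases q)
    have "b = -1 \<and> c = 1 \<and> d = 0 \<and> n \<le> - a \<and> - a \<le> n + 1 \<or> b = a - 1 \<and> c = 1 \<and> d = 1 \<and> n = - a"
      using quad_weight_1_cases[of a b c d "of_int n"] that nz unfolding q by (auto; linarith)
    then show False using that unfolding q by auto
  qed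
qed (auto simp: quads_def)

text \<open>The only contributing fixed point lies on the unit arc strictly between the corners,
  with weight \<open>1/2\<close>.\<close>

lemma has_sum_quad_weight_1_nonint:
  assumes "x \<notin> \<int>"
  shows "(quad_weight x 1 has_sum (1/2)) quads"
proof (rule has_sum_cong_neutral[THEN iffD1])
  let ?S = "{(- \<lceil>x\<rceil>, -1, 1, 0)}"
  have ne: "x \<noteq> of_int k" for k using assms by auto
  have "of_int \<lceil>x\<rceil> - x > 0" "of_int \<lceil>x\<rceil> - x < 1"
    using ne[of "\<lceil>x\<rceil>"] by linarith+
  then show "(quad_weight x 1 has_sum (1/2)) ?S"
    by (intro has_sum_finiteI) (auto simp: quad_weight_def form_B_def form_E_def cone_weight_def)
  show "quad_weight x 1 q = 0" if "q \<in> quads - ?S" for q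
  proof (rule ccontr)
    assume nz: "quad_weight x 1 q \<noteq> 0"
    obtain a b c d where q: "q = (a, b, c, d)" by (cases q)
    have "b = -1 \<and> c = 1 \<and> d = 0 \<and> x \<le> of_int (- a) \<and> of_int (- a) \<le> x + 1"
      using quad_weight_1_cases[of a b c d x] that nz ne[of "- a"] unfolding q by auto
    moreover from this have "- a = \<lceil>x\<rceil>" using ne[of "- a - 1"] by (intro ceiling_unique[symmetric]) auto
    ultimately show False using that unfolding q by auto
  qed
qed (auto simp: quads_def)

section \<open>From integer quadruples to the modular group\<close>

definition quad_matrix :: "int \<times> int \<times> int \<times> int \<Rightarrow> int^2^2" where
  "quad_matrix = (\<lambda>(a, b, c, d). vector [vector [a, b], vector [c, d]])"

lemma quad_matrix_nth [simp]:
  "quad_matrix (a, b, c, d) $ 1 $ 1 = a" "quad_matrix (a, b, c, d) $ 1 $ 2 = b"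
  "quad_matrix (a, b, c, d) $ 2 $ 1 = c" "quad_matrix (a, b, c, d) $ 2 $ 2 = d"
  by (simp_all add: quad_matrix_def)

text \<open>One of \<open>A\<close> and \<open>- A\<close> has positive lower left entry unless that
  entry is \<open>0\<close>; then the diagonal entries are both \<open>1\<close> or both
  \<open>-1\<close>, and the class is a translation.\<close>

lemma carrier_PSL2Z_quads:
  "carrier PSL2Z = (\<lambda>q. {quad_matrix q, - quad_matrix q}) ` quads \<union>
     (\<lambda>n. {quad_matrix (1, n, 0, 1), - quad_matrix (1, n, 0, 1)}) ` UNIV" (is "_ = ?L \<union> ?R")
proof
  show "carrier PSL2Z \<subseteq> ?L \<union> ?R"
  proof
    fix X assume "X \<in> carrier PSL2Z"
    then obtain A where A: "X = {A, - A}" "det A = 1" by (auto simp: carrier_PSL2Z)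
    have det: "A$1$1 * A$2$2 - A$1$2 * A$2$1 = 1" using A(2) by (simp add: det_2)
    consider "A$2$1 > 0" | "A$2$1 < 0" | "A$2$1 = 0" by linarith
    then show "X \<in> ?L \<union> ?R"
    proof cases
      case 1
      let ?q = "(A$1$1, A$1$2, A$2$1, A$2$2)"
      have "quad_matrix ?q = A" "?q \<in> quads" using 1 det by (auto simp: matrix_eq_2 quads_def)
      then show ?thesis using A(1) by (intro UnI1 image_eqI[of _ _ ?q]) auto
    next
      case 2
      let ?q = "(- A$1$1, - A$1$2, - A$2$1, - A$2$2)"
      have "quad_matrix ?q = - A" "?q \<in> quads" using 2 det by (auto simp: matrix_eq_2 quads_def)
      then show ?thesis using A(1) by (intro UnI1 image_eqI[of _ _ ?q]) auto
    next
      case 3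
      then have "A$1$1 * A$2$2 = 1" using det by simp
      then consider "A$1$1 = 1" "A$2$2 = 1" | "A$1$1 = -1" "A$2$2 = -1" by (auto simp: zmult_eq_1_iff)
      then show ?thesis
      proof cases
        case 1
        then have "quad_matrix (1, A$1$2, 0, 1) = A" using 3 by (simp add: matrix_eq_2)
        then show ?thesis using A(1) by (intro UnI2 image_eqI[of _ _ "A$1$2"]) auto
      next
        case 2
        then have "quad_matrix (1, - A$1$2, 0, 1) = - A" using 3 by (simp add: matrix_eq_2)
        then show ?thesis using A(1) by (intro UnI2 image_eqI[of _ _ "- A$1$2"]) auto
      qed
    qed
  qed
  have "det (quad_matrix q) = 1" if "q \<in> quads \<or> (\<exists>n. q = (1, n, 0, 1))" for q
    using that by (cases q) (auto simp: det_2 quads_def)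
  then show "?L \<union> ?R \<subseteq> carrier PSL2Z" unfolding carrier_PSL2Z by auto
qed

lemma pm_quad_matrix_eq_iff:
  "{quad_matrix (a, b, c, d), - quad_matrix (a, b, c, d)} = {quad_matrix (a', b', c', d'), - quad_matrix (a', b', c', d')} \<longleftrightarrow>
    (a, b, c, d) = (a', b', c', d') \<or> (a, b, c, d) = (- a', - b', - c', - d')"
  by (auto simp: doubleton_eq_iff matrix_eq_2)

lemma alpha_PSL_quad:
  assumes "q \<in> quads"
  shows "alpha_PSL (vector [vector [y, x], vector [0, 1]]) {quad_matrix q, - quad_matrix q} = quad_weight x y q"
proof -
  obtain a b c d where q: "q = (a, b, c, d)" by (cases q)
  let ?N = "vector [vector [y, x], vector [0, 1]] ** map_matrix real_of_int (quad_matrix q) :: real^2^2"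
  have N: "?N$1$1 = y * of_int a + x * of_int c" "?N$1$2 = y * of_int b + x * of_int d"
    "?N$2$1 = of_int c" "?N$2$2 = of_int d"
    by (simp_all add: q matrix_matrix_mult_def sum_2)
  have "alpha ?N = cone_weight (?N$2$1) (?N$2$2 - ?N$1$1) (- ?N$1$2 - ?N$2$1)"
    by (rule alpha_eq_cone_weight) (use assms in \<open>simp add: N, simp add: q quads_def\<close>)
  then show ?thesis
    unfolding alpha_PSL_eq N by (simp add: q quad_weight_def form_B_def form_E_def algebra_simps)
qed

text \<open>The product has trace \<open>y + 1\<close> and determinant \<open>y\<close>, and
  \<open>(y + 1)^2 - 4 y = (y - 1)^2\<close> is nonnegative. Only a scalar product can
  contribute.\<close>

lemma alpha_PSL_translation:
  "alpha_PSL (vector [vector [y, x], vector [0, 1]]) {quad_matrix (1, n, 0, 1), - quad_matrix (1, n, 0, 1)} =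
     (if y = 1 \<and> x = of_int (- n) then - 1/12 else 0)"
proof -
  let ?N = "vector [vector [y, x], vector [0, 1]] ** map_matrix real_of_int (quad_matrix (1, n, 0, 1)) :: real^2^2"
  have N: "?N$1$1 = y" "?N$1$2 = y * of_int n + x" "?N$2$1 = 0" "?N$2$2 = 1"
    by (simp_all add: matrix_matrix_mult_def sum_2)
  have "4 * y \<le> (y + 1)\<^sup>2"
    using zero_le_power2[of "y - 1"] by (simp add: power2_eq_square algebra_simps)
  then have "\<not> elliptic ?N"
    unfolding elliptic_def trace_def det_2 sum_2 N by simp
  moreover have "(\<exists>k. ?N = mat k) \<longleftrightarrow> y = 1 \<and> x = of_int (- n)"
    unfolding matrix_eq_2 N by (auto simp: mat_def)
  ultimately show ?thesis unfolding alpha_PSL_eq alpha_def by simp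
qed

lemma has_sum_alpha_PSL:
  assumes "(quad_weight x y has_sum s) quads"
  shows "(alpha_PSL (vector [vector [y, x], vector [0, 1]]) has_sum
    (s + (if y = 1 \<and> x \<in> \<int> then - 1/12 else 0))) (carrier PSL2Z)"
proof -
  let ?f = "alpha_PSL (vector [vector [y, x], vector [0, 1]])"
  let ?g = "\<lambda>q. {quad_matrix q, - quad_matrix q}"
  have inj: "inj_on ?g quads"
  proof (rule inj_onI)
    fix q q' assume "q \<in> quads" "q' \<in> quads" "?g q = ?g q'"
    then show "q = q'" by (cases q; cases q') (auto simp: pm_quad_matrix_eq_iff quads_def)
  qed
  have inj': "inj (\<lambda>n. ?g (1, n, 0, 1))"
    by (rule injI) (auto simp: pm_quad_matrix_eq_iff)
  have 1: "(?f has_sum s) (?g ` quads)"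
    using has_sum_cong[of quads "?f \<circ> ?g" "quad_weight x y" s] assms
    by (simp add: has_sum_reindex[OF inj] alpha_PSL_quad)
  have "((\<lambda>n. if y = 1 \<and> x = of_int (- n) then - 1/12 else 0 :: real) has_sum (if y = 1 \<and> x \<in> \<int> then - 1/12 else 0)) UNIV"
  proof (cases "y = 1 \<and> x \<in> \<int>")
    case True
    then obtain n where n: "x = of_int n" by (auto elim: Ints_cases)
    have "((\<lambda>m. if y = 1 \<and> x = of_int (- m) then - 1/12 else 0 :: real) has_sum (- 1/12)) {- n}"
      using True n by (intro has_sum_finiteI) auto
    then have "((\<lambda>m. if y = 1 \<and> x = of_int (- m) then - 1/12 else 0 :: real) has_sum (- 1/12)) UNIV"
      by (rule has_sum_cong_neutral[THEN iffD1, rotated -1]) (auto simp: n)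
    then show ?thesis using True by simp
  next
    case False
    then have "\<not> (y = 1 \<and> x = of_int (- n))" for n by auto
    then show ?thesis using False by (simp only: if_False has_sum_0_simp)
  qed
  then have 2: "(?f has_sum (if y = 1 \<and> x \<in> \<int> then - 1/12 else 0)) ((\<lambda>n. ?g (1, n, 0, 1)) ` UNIV)"
    by (simp only: has_sum_reindex[OF inj'] o_def alpha_PSL_translation)
  have "?g ` quads \<inter> (\<lambda>n. ?g (1, n, 0, 1)) ` UNIV = {}"
    by (auto simp: pm_quad_matrix_eq_iff quads_def)
  then show ?thesis
    unfolding carrier_PSL2Z_quads using has_sum_Un_disjoint[OF 1 2] by blast
qed

theorem theorem3:
  fixes x y :: real
  assumes "y > 0"
  shows "(alpha_PSL (vector [vector [y, x], vector [0, 1]]) has_sum (1 + sgn (y - 1)) / 2)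
           (carrier PSL2Z)"
proof -
  \<comment> \<open>For \<open>y = 1\<close> and integral \<open>x\<close> the scalar matrix
    corrects \<open>7/12\<close> to \<open>1/2\<close>; for other \<open>x\<close> no scalar matrix
    occurs and the value is \<open>1/2\<close> already.\<close>
  consider "y < 1" | "y > 1" | "y = 1" "x \<notin> \<int>" | n where "y = 1" "x = of_int n"
    by (metis Ints_cases linorder_less_linear)
  then show ?thesis
  proof cases
    case 1
    then show ?thesis using has_sum_alpha_PSL[OF has_sum_quad_weight_lt_1[OF 1, of x]] by simp
  next
    case 2
    then show ?thesis using has_sum_alpha_PSL[OF has_sum_quad_weight_gt_1[OF 2, of x]] by simp
  next
    case 3
    then show ?thesis using has_sum_alpha_PSL[OF has_sum_quad_weight_1_nonint[OF 3(2)]] by simp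
  next
    case 4
    then show ?thesis using has_sum_alpha_PSL[OF has_sum_quad_weight_1_int[of n]] by simp
  qed
qed

end
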